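(* Let $\mathcal{C}$ be a cocomplete category with stable and disjoint coproducts and all pullbacks. For each object $X$ of $\mathcal{C}$, define a collection $K(X)$ of families of morphisms with codomain $X$ by $$\{A_\alpha\to X\}_{\alpha\in\mathcal{A}}\in K(X)\iff \coprod_{\alpha\in\mathcal{A}}A_\alpha\to X\text{ is a universal effective epimorphism.}$$ Then $K$ is a Grothendieck basis and generates the canonical topology on $\mathcal{C}$.
   Context: Let $E=\coprod_\alpha E_\alpha$ be a coproduct with inclusions $i_\alpha\colon E_\alpha\to E$. It is disjoint if every $i_\alpha$ is a monomorphism and $E_\alpha\times_E E_\beta$ is an initial object whenever $\alpha\neq\beta$. It is stable if for every $f\colon D\to E$ the projections $D\times_E E_\alpha\to D$ induce an isomorphism $\coprod_\alpha(D\times_E E_\alpha)\cong D$. A morphism $f\colon Y\to X$ is an effective epimorphism if $Y\times_X Y$ exists, $f$ is an epimorphism, and the canonical map $\operatorname{Coeq}(Y\times_X Y\rightrightarrows Y)\to X$ is an isomorphism; it is a universal effective epimorphism if moreover every pullback of $f$ along a morphism $Z\to X$ is an effective epimorphism. $K$ is a Grothendieck basis if: (1) $\{f\colon E\to X\}\in K(X)$ for every isomorphism $f$; (2) if $\{f_i\colon E_i\to X\}_{i\in I}\in K(X)$ and $g\colon Y\to X$, then $\{\pi_2\colon E_i\times_X Y\to Y\}_{i\in I}\in K(Y)$; (3) if $\{f_i\colon E_i\to X\}_{i\in I}\in K(X)$ and $\{g_{ij}\colon D_{ij}\to E_i\}_{j\in J_i}\in K(E_i)$ for each $i\in I$, then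 $\{f_i\circ g_{ij}\colon D_{ij}\to X\}_{i\in I,j\in J_i}\in K(X)$. The topology generated by $K$ is the one in which a sieve on $X$ is covering if and only if it contains some family belonging to $K(X)$. The canonical topology on $\mathcal{C}$ is the largest Grothendieck topology for which all representable presheaves are sheaves.
   Formalization: Families are small. K generates the canonical topology provided each canonical covering sieve contains a small family generating a cover (necessary; can fail). In general K generates the largest topology with this property for which representable presheaves are sheaves. *)

theory Defs
  imports Main
begin

unbundle cardinal_syntax

section \<open>Size\<close>

text \<open>
  "Small" is measured by a regular infinite cardinal \<open>\<kappa>\<close>: a set is small if it has fewer than
  \<open>\<kappa>\<close> elements.  For \<open>\<kappa>\<close> inaccessible this is smallness relative to a Grothendieck universe.
  No smallness is demanded of the category under consideration, nor of its hom-sets.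
  Every small set is in bijection with a set of elements of the type \<open>'u\<close> carrying \<open>\<kappa>\<close>, so
  index sets and small diagram categories are taken in \<open>'u\<close>.
\<close>

definition small :: "'u rel \<Rightarrow> 'b set \<Rightarrow> bool" where
  "small \<kappa> A \<longleftrightarrow> |A| <o \<kappa>"

section \<open>Categories, functors, colimits\<close>

record ('o, 'a) cat =
  Ob :: "'o set"
  Ar :: "'a set"
  Dom :: "'a \<Rightarrow> 'o"
  Cod :: "'a \<Rightarrow> 'o"
  Idn :: "'o \<Rightarrow> 'a"
  Comp :: "'a \<Rightarrow> 'a \<Rightarrow> 'a"  (infixl "\<cdot>\<index>" 75)

text \<open>\<open>g \<cdot>\<^bsub>C\<^esub> f\<close> is "first \<open>f\<close>, then \<open>g\<close>"; it is meaningful only if \<open>Cod C f = Dom C g\<close>.\<close>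

definition hom :: "('o, 'a) cat \<Rightarrow> 'o \<Rightarrow> 'o \<Rightarrow> 'a set" where
  "hom C X Y = {f \<in> Ar C. Dom C f = X \<and> Cod C f = Y}"

locale category =
  fixes C :: "('o, 'a) cat" (structure)
  assumes dom_Ob: "f \<in> Ar C \<Longrightarrow> Dom C f \<in> Ob C"
    and cod_Ob: "f \<in> Ar C \<Longrightarrow> Cod C f \<in> Ob C"
    and idn_hom: "X \<in> Ob C \<Longrightarrow> Idn C X \<in> hom C X X"
    and comp_hom: "f \<in> hom C X Y \<Longrightarrow> g \<in> hom C Y Z \<Longrightarrow> g \<cdot> f \<in> hom C X Z"
    and idn_left: "f \<in> hom C X Y \<Longrightarrow> Idn C Y \<cdot> f = f"
    and idn_right: "f \<in> hom C X Y \<Longrightarrow> f \<cdot> Idn C X = f"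
    and comp_assoc: "f \<in> hom C W X \<Longrightarrow> g \<in> hom C X Y \<Longrightarrow> h \<in> hom C Y Z \<Longrightarrow>
      (h \<cdot> g) \<cdot> f = h \<cdot> (g \<cdot> f)"

definition is_functor ::
  "('p, 'b) cat \<Rightarrow> ('o, 'a) cat \<Rightarrow> ('p \<Rightarrow> 'o) \<Rightarrow> ('b \<Rightarrow> 'a) \<Rightarrow> bool" where
  "is_functor J C F0 F1 \<longleftrightarrow>
    (\<forall>j\<in>Ob J. F0 j \<in> Ob C \<and> F1 (Idn J j) = Idn C (F0 j)) \<and>
    (\<forall>a\<in>Ar J. F1 a \<in> hom C (F0 (Dom J a)) (F0 (Cod J a))) \<and>
    (\<forall>a\<in>Ar J. \<forall>b\<in>Ar J. Cod J a = Dom J b \<longrightarrow> F1 (b \<cdot>\<^bsub>J\<^esub> a) = F1 b \<cdot>\<^bsub>C\<^esub> F1 a)"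

definition is_cocone ::
  "('p, 'b) cat \<Rightarrow> ('o, 'a) cat \<Rightarrow> ('p \<Rightarrow> 'o) \<Rightarrow> ('b \<Rightarrow> 'a) \<Rightarrow> 'o \<Rightarrow> ('p \<Rightarrow> 'a) \<Rightarrow> bool" where
  "is_cocone J C F0 F1 L c \<longleftrightarrow>
    L \<in> Ob C \<and> (\<forall>j\<in>Ob J. c j \<in> hom C (F0 j) L) \<and>
    (\<forall>a\<in>Ar J. c (Cod J a) \<cdot>\<^bsub>C\<^esub> F1 a = c (Dom J a))"

definition is_colimit ::
  "('p, 'b) cat \<Rightarrow> ('o, 'a) cat \<Rightarrow> ('p \<Rightarrow> 'o) \<Rightarrow> ('b \<Rightarrow> 'a) \<Rightarrow> 'o \<Rightarrow> ('p \<Rightarrow> 'a) \<Rightarrow> bool" where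
  "is_colimit J C F0 F1 L c \<longleftrightarrow>
    is_cocone J C F0 F1 L c \<and>
    (\<forall>M d. is_cocone J C F0 F1 M d \<longrightarrow>
      (\<exists>!u. u \<in> hom C L M \<and> (\<forall>j\<in>Ob J. u \<cdot>\<^bsub>C\<^esub> c j = d j)))"

definition cocomplete :: "'u rel \<Rightarrow> ('o, 'a) cat \<Rightarrow> bool" where
  "cocomplete \<kappa> C \<longleftrightarrow>
    (\<forall>(J :: ('u, 'u) cat) F0 F1.
      category J \<and> small \<kappa> (Ob J) \<and> small \<kappa> (Ar J) \<and> is_functor J C F0 F1 \<longrightarrow>
      (\<exists>L c. is_colimit J C F0 F1 L c))"

definition is_mono :: "('o, 'a) cat \<Rightarrow> 'a \<Rightarrow> bool" where
  "is_mono C f \<longleftrightarrow> f \<in> Ar C \<and>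
    (\<forall>W. \<forall>g\<in>hom C W (Dom C f). \<forall>h\<in>hom C W (Dom C f). f \<cdot>\<^bsub>C\<^esub> g = f \<cdot>\<^bsub>C\<^esub> h \<longrightarrow> g = h)"

definition is_epi :: "('o, 'a) cat \<Rightarrow> 'a \<Rightarrow> bool" where
  "is_epi C f \<longleftrightarrow> f \<in> Ar C \<and>
    (\<forall>Z. \<forall>g\<in>hom C (Cod C f) Z. \<forall>h\<in>hom C (Cod C f) Z. g \<cdot>\<^bsub>C\<^esub> f = h \<cdot>\<^bsub>C\<^esub> f \<longrightarrow> g = h)"

definition is_iso :: "('o, 'a) cat \<Rightarrow> 'a \<Rightarrow> bool" where
  "is_iso C f \<longleftrightarrow> f \<in> Ar C \<and>
    (\<exists>g\<in>hom C (Cod C f) (Dom C f).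
      g \<cdot>\<^bsub>C\<^esub> f = Idn C (Dom C f) \<and> f \<cdot>\<^bsub>C\<^esub> g = Idn C (Cod C f))"

definition is_initial :: "('o, 'a) cat \<Rightarrow> 'o \<Rightarrow> bool" where
  "is_initial C Z \<longleftrightarrow> Z \<in> Ob C \<and> (\<forall>X\<in>Ob C. \<exists>!f. f \<in> hom C Z X)"

definition is_pullback ::
  "('o, 'a) cat \<Rightarrow> 'a \<Rightarrow> 'a \<Rightarrow> 'o \<Rightarrow> 'a \<Rightarrow> 'a \<Rightarrow> bool" where
  "is_pullback C f g P p q \<longleftrightarrow>
    f \<in> Ar C \<and> g \<in> Ar C \<and> Cod C f = Cod C g \<and>
    p \<in> hom C P (Dom C f) \<and> q \<in> hom C P (Dom C g) \<and> f \<cdot>\<^bsub>C\<^esub> p = g \<cdot>\<^bsub>C\<^esub> q \<and>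
    (\<forall>W. \<forall>r\<in>hom C W (Dom C f). \<forall>s\<in>hom C W (Dom C g). f \<cdot>\<^bsub>C\<^esub> r = g \<cdot>\<^bsub>C\<^esub> s \<longrightarrow>
      (\<exists>!u. u \<in> hom C W P \<and> p \<cdot>\<^bsub>C\<^esub> u = r \<and> q \<cdot>\<^bsub>C\<^esub> u = s))"

definition has_pullbacks :: "('o, 'a) cat \<Rightarrow> bool" where
  "has_pullbacks C \<longleftrightarrow>
    (\<forall>f\<in>Ar C. \<forall>g\<in>Ar C. Cod C f = Cod C g \<longrightarrow> (\<exists>P p q. is_pullback C f g P p q))"

definition is_coequalizer ::
  "('o, 'a) cat \<Rightarrow> 'a \<Rightarrow> 'a \<Rightarrow> 'o \<Rightarrow> 'a \<Rightarrow> bool" where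
  "is_coequalizer C p q Q c \<longleftrightarrow>
    p \<in> Ar C \<and> q \<in> Ar C \<and> Dom C p = Dom C q \<and> Cod C p = Cod C q \<and>
    c \<in> hom C (Cod C p) Q \<and> c \<cdot>\<^bsub>C\<^esub> p = c \<cdot>\<^bsub>C\<^esub> q \<and>
    (\<forall>Z. \<forall>d\<in>hom C (Cod C p) Z. d \<cdot>\<^bsub>C\<^esub> p = d \<cdot>\<^bsub>C\<^esub> q \<longrightarrow>
      (\<exists>!u. u \<in> hom C Q Z \<and> u \<cdot>\<^bsub>C\<^esub> c = d))"

definition is_coproduct ::
  "('o, 'a) cat \<Rightarrow> 'u set \<Rightarrow> ('u \<Rightarrow> 'o) \<Rightarrow> 'o \<Rightarrow> ('u \<Rightarrow> 'a) \<Rightarrow> bool" where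
  "is_coproduct C I A E inc \<longleftrightarrow>
    E \<in> Ob C \<and> (\<forall>i\<in>I. A i \<in> Ob C \<and> inc i \<in> hom C (A i) E) \<and>
    (\<forall>Z\<in>Ob C. \<forall>h. (\<forall>i\<in>I. h i \<in> hom C (A i) Z) \<longrightarrow>
      (\<exists>!u. u \<in> hom C E Z \<and> (\<forall>i\<in>I. u \<cdot>\<^bsub>C\<^esub> inc i = h i)))"

definition disjoint_coproduct ::
  "('o, 'a) cat \<Rightarrow> 'u set \<Rightarrow> ('u \<Rightarrow> 'a) \<Rightarrow> bool" where
  "disjoint_coproduct C I inc \<longleftrightarrow>
    (\<forall>i\<in>I. is_mono C (inc i)) \<and>
    (\<forall>i\<in>I. \<forall>j\<in>I. i \<noteq> j \<longrightarrow>
      (\<forall>P p q. is_pullback C (inc i) (inc j) P p q \<longrightarrow> is_initial C P))"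

definition stable_coproduct ::
  "('o, 'a) cat \<Rightarrow> 'u set \<Rightarrow> 'o \<Rightarrow> ('u \<Rightarrow> 'a) \<Rightarrow> bool" where
  "stable_coproduct C I E inc \<longleftrightarrow>
    (\<forall>f\<in>Ar C. Cod C f = E \<longrightarrow>
      (\<forall>P p q. (\<forall>i\<in>I. is_pullback C f (inc i) (P i) (p i) (q i)) \<longrightarrow>
        (\<forall>Q k u. is_coproduct C I P Q k \<and> u \<in> hom C Q (Dom C f) \<and>
            (\<forall>i\<in>I. u \<cdot>\<^bsub>C\<^esub> k i = p i) \<longrightarrow> is_iso C u)))"

definition stable_disjoint_coproducts :: "'u rel \<Rightarrow> ('o, 'a) cat \<Rightarrow> bool" where
  "stable_disjoint_coproducts \<kappa> C \<longleftrightarrow>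
    (\<forall>(I :: 'u set) A E inc. small \<kappa> I \<and> is_coproduct C I A E inc \<longrightarrow>
      stable_coproduct C I E inc \<and> disjoint_coproduct C I inc)"

definition effective_epi :: "('o, 'a) cat \<Rightarrow> 'a \<Rightarrow> bool" where
  "effective_epi C f \<longleftrightarrow> is_epi C f \<and>
    (\<exists>P p q. is_pullback C f f P p q \<and>
      (\<exists>Q c u. is_coequalizer C p q Q c \<and> u \<in> hom C Q (Cod C f) \<and> u \<cdot>\<^bsub>C\<^esub> c = f \<and> is_iso C u))"

definition universal_effective_epi :: "('o, 'a) cat \<Rightarrow> 'a \<Rightarrow> bool" where
  "universal_effective_epi C f \<longleftrightarrow> effective_epi C f \<and>
    (\<forall>g P p q. is_pullback C f g P p q \<longrightarrow> effective_epi C q)"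

section \<open>Families and Grothendieck bases\<close>

text \<open>
  An indexed family of morphisms is a pair of an index set and a function; values of the function
  outside the index set are irrelevant.
\<close>

type_synonym ('u, 'a) family = "'u set \<times> ('u \<Rightarrow> 'a)"

definition family_on :: "'u rel \<Rightarrow> ('o, 'a) cat \<Rightarrow> 'o \<Rightarrow> ('u, 'a) family \<Rightarrow> bool" where
  "family_on \<kappa> C X = (\<lambda>(I, f). small \<kappa> I \<and> (\<forall>i\<in>I. f i \<in> Ar C \<and> Cod C (f i) = X))"

text \<open>
  The composite family in the third axiom is naturally indexed by \<open>Sigma I J :: ('u \<times> 'u) set\<close>;
  it is reindexed along an arbitrary bijection with a set of elements of \<open>'u\<close>.
\<close>

definition grothendieck_basis ::
  "'u rel \<Rightarrow> ('o, 'a) cat \<Rightarrow> ('o \<Rightarrow> ('u, 'a) family set) \<Rightarrow> bool" where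
  "grothendieck_basis \<kappa> C K \<longleftrightarrow>
    (\<forall>X\<in>Ob C. \<forall>F\<in>K X. family_on \<kappa> C X F) \<and>
    (\<forall>f i. is_iso C f \<longrightarrow> ({i}, \<lambda>_. f) \<in> K (Cod C f)) \<and>
    (\<forall>X\<in>Ob C. \<forall>I f g P p q.
      (I, f) \<in> K X \<and> g \<in> Ar C \<and> Cod C g = X \<and>
      (\<forall>i\<in>I. is_pullback C (f i) g (P i) (p i) (q i)) \<longrightarrow>
      (I, q) \<in> K (Dom C g)) \<and>
    (\<forall>X\<in>Ob C. \<forall>I f J g.
      (I, f) \<in> K X \<and> (\<forall>i\<in>I. (J i, g i) \<in> K (Dom C (f i))) \<longrightarrow>
      (\<forall>L b. bij_betw b L (Sigma I J) \<longrightarrow>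
        (L, \<lambda>l. case b l of (i, j) \<Rightarrow> f i \<cdot>\<^bsub>C\<^esub> g i j) \<in> K X))"

definition coproduct_basis :: "'u rel \<Rightarrow> ('o, 'a) cat \<Rightarrow> 'o \<Rightarrow> ('u, 'a) family set" where
  "coproduct_basis \<kappa> C X = {(I, f). family_on \<kappa> C X (I, f) \<and>
    (\<exists>E inc u. is_coproduct C I (\<lambda>i. Dom C (f i)) E inc \<and>
      u \<in> hom C E X \<and> (\<forall>i\<in>I. u \<cdot>\<^bsub>C\<^esub> inc i = f i) \<and> universal_effective_epi C u)}"

section \<open>Sieves, topologies, sheaves\<close>

definition sieve :: "('o, 'a) cat \<Rightarrow> 'o \<Rightarrow> 'a set \<Rightarrow> bool" where
  "sieve C X S \<longleftrightarrow> S \<subseteq> {f \<in> Ar C. Cod C f = X} \<and>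
    (\<forall>f\<in>S. \<forall>g\<in>Ar C. Cod C g = Dom C f \<longrightarrow> f \<cdot>\<^bsub>C\<^esub> g \<in> S)"

definition pullback_sieve :: "('o, 'a) cat \<Rightarrow> 'a \<Rightarrow> 'a set \<Rightarrow> 'a set" where
  "pullback_sieve C h S = {g \<in> Ar C. Cod C g = Dom C h \<and> h \<cdot>\<^bsub>C\<^esub> g \<in> S}"

definition generated_sieve :: "('o, 'a) cat \<Rightarrow> 'a set \<Rightarrow> 'a set" where
  "generated_sieve C F = {f \<cdot>\<^bsub>C\<^esub> g | f g. f \<in> F \<and> g \<in> Ar C \<and> Cod C g = Dom C f}"

definition grothendieck_topology :: "('o, 'a) cat \<Rightarrow> ('o \<Rightarrow> 'a set set) \<Rightarrow> bool" where
  "grothendieck_topology C T \<longleftrightarrow>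
    (\<forall>X\<in>Ob C. \<forall>S\<in>T X. sieve C X S) \<and>
    (\<forall>X\<in>Ob C. {f \<in> Ar C. Cod C f = X} \<in> T X) \<and>
    (\<forall>X\<in>Ob C. \<forall>S\<in>T X. \<forall>h\<in>Ar C. Cod C h = X \<longrightarrow> pullback_sieve C h S \<in> T (Dom C h)) \<and>
    (\<forall>X\<in>Ob C. \<forall>S\<in>T X. \<forall>R. sieve C X R \<and> (\<forall>h\<in>S. pullback_sieve C h R \<in> T (Dom C h)) \<longrightarrow>
      R \<in> T X)"

definition generated_topology ::
  "('o, 'a) cat \<Rightarrow> ('o \<Rightarrow> ('u, 'a) family set) \<Rightarrow> 'o \<Rightarrow> 'a set set" where
  "generated_topology C K X = {S. sieve C X S \<and> (\<exists>(I, f)\<in>K X. f ` I \<subseteq> S)}"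

text \<open>A presheaf is given by its sets \<open>F0 X\<close> and its restriction maps \<open>F1 f\<close>.\<close>

definition is_sheaf ::
  "('o, 'a) cat \<Rightarrow> ('o \<Rightarrow> 'a set set) \<Rightarrow> ('o \<Rightarrow> 'v set) \<Rightarrow> ('a \<Rightarrow> 'v \<Rightarrow> 'v) \<Rightarrow> bool" where
  "is_sheaf C T F0 F1 \<longleftrightarrow>
    (\<forall>X\<in>Ob C. \<forall>S\<in>T X. \<forall>x.
      (\<forall>f\<in>S. x f \<in> F0 (Dom C f)) \<and>
      (\<forall>f\<in>S. \<forall>g\<in>Ar C. Cod C g = Dom C f \<longrightarrow> F1 g (x f) = x (f \<cdot>\<^bsub>C\<^esub> g)) \<longrightarrow>
      (\<exists>!s. s \<in> F0 X \<and> (\<forall>f\<in>S. F1 f s = x f)))"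

definition subcanonical_topology :: "('o, 'a) cat \<Rightarrow> ('o \<Rightarrow> 'a set set) \<Rightarrow> bool" where
  "subcanonical_topology C T \<longleftrightarrow> grothendieck_topology C T \<and>
    (\<forall>Z\<in>Ob C. is_sheaf C T (\<lambda>X. hom C X Z) (\<lambda>g s. s \<cdot>\<^bsub>C\<^esub> g))"

definition canonical_topology :: "('o, 'a) cat \<Rightarrow> ('o \<Rightarrow> 'a set set) \<Rightarrow> bool" where
  "canonical_topology C T \<longleftrightarrow> subcanonical_topology C T \<and>
    (\<forall>T'. subcanonical_topology C T' \<longrightarrow> (\<forall>X\<in>Ob C. T' X \<subseteq> T X))"

text \<open>
  In a large category a covering sieve need not contain any small covering family, whereas the
  members of a topology generated by small families do.  For instance, in the category of those
  presheaves of small sets on the ordered set \<open>\<kappa>\<close> all of whose restriction maps beyond some stage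
  are bijective, the sieve on the terminal object generated by all proper initial segments of
  \<open>\<kappa>\<close> covers for the canonical topology, but no small part of it is even jointly epimorphic.
  So "canonical" is also needed relative to topologies whose covers come from small families.
\<close>

definition small_covers :: "'u rel \<Rightarrow> ('o, 'a) cat \<Rightarrow> ('o \<Rightarrow> 'a set set) \<Rightarrow> bool" where
  "small_covers \<kappa> C T \<longleftrightarrow>
    (\<forall>X\<in>Ob C. \<forall>S\<in>T X. \<exists>F\<subseteq>S. small \<kappa> F \<and> generated_sieve C F \<in> T X)"

definition small_canonical_topology ::
  "'u rel \<Rightarrow> ('o, 'a) cat \<Rightarrow> ('o \<Rightarrow> 'a set set) \<Rightarrow> bool" where
  "small_canonical_topology \<kappa> C T \<longleftrightarrow> subcanonical_topology C T \<and> small_covers \<kappa> C T \<and>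
    (\<forall>T'. subcanonical_topology C T' \<and> small_covers \<kappa> C T' \<longrightarrow> (\<forall>X\<in>Ob C. T' X \<subseteq> T X))"

end

theory Submission
  imports Defs
begin

text \<open>
  Call a sieve effective if every hom-presheaf satisfies the sheaf condition for it.  The sieves
  all of whose pullbacks are effective form the canonical topology.  A morphism is a universal
  effective epimorphism exactly if the sieve it generates is universally effective.  The inclusions
  of a coproduct generate an effective sieve by the universal property, and a universally
  effective one by stability.  Transitivity then shows that a family \<open>A\<^sub>i \<rightarrow> X\<close> generates
  a universally effective sieve exactly if \<open>\<Coprod>\<^sub>i A\<^sub>i \<rightarrow> X\<close> is a universal effective epimorphism.
  Hence the members of the basis are the small families that generate canonical covers, and the
  axioms follow from those of a topology.
\<close>

section \<open>Composition, pullbacks and sieves\<close>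

context category
begin

lemma homI: "f \<in> Ar C \<Longrightarrow> Dom C f = X \<Longrightarrow> Cod C f = Y \<Longrightarrow> f \<in> hom C X Y"
  by (simp add: hom_def)

lemma homD:
  assumes "f \<in> hom C X Y"
  shows "f \<in> Ar C" "Dom C f = X" "Cod C f = Y"
  using assms by (simp_all add: hom_def)

lemma comp_Ar [simp]:
  assumes "f \<in> Ar C" "g \<in> Ar C" "Cod C f = Dom C g"
  shows "g \<cdot> f \<in> Ar C" "Dom C (g \<cdot> f) = Dom C f" "Cod C (g \<cdot> f) = Cod C g"
  using comp_hom[of f "Dom C f" "Cod C f" g "Cod C g"] assms by (simp_all add: hom_def)

lemma assoc [simp]:
  assumes "f \<in> Ar C" "g \<in> Ar C" "h \<in> Ar C" "Cod C f = Dom C g" "Cod C g = Dom C h"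
  shows "h \<cdot> g \<cdot> f = h \<cdot> (g \<cdot> f)"
  using comp_assoc[of f "Dom C f" "Cod C f" g "Cod C g" h "Cod C h"] assms
  by (simp add: hom_def)

lemma Idn_Ar [simp]:
  assumes "X \<in> Ob C"
  shows "Idn C X \<in> Ar C" "Dom C (Idn C X) = X" "Cod C (Idn C X) = X"
  using idn_hom[OF assms] by (simp_all add: hom_def)

lemma Idn_comp [simp]: "f \<in> Ar C \<Longrightarrow> Cod C f = X \<Longrightarrow> Idn C X \<cdot> f = f"
  using idn_left[of f "Dom C f" X] by (simp add: hom_def)

lemma comp_Idn [simp]: "f \<in> Ar C \<Longrightarrow> Dom C f = X \<Longrightarrow> f \<cdot> Idn C X = f"
  using idn_right[of f X "Cod C f"] by (simp add: hom_def)

declare dom_Ob [simp] cod_Ob [simp]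

section \<open>Pullback squares\<close>

lemma is_pullbackD:
  assumes "is_pullback C f g P p q"
  shows "f \<in> Ar C" "g \<in> Ar C" "Cod C f = Cod C g" "p \<in> Ar C" "q \<in> Ar C"
    "Dom C p = P" "Cod C p = Dom C f" "Dom C q = P" "Cod C q = Dom C g" "f \<cdot> p = g \<cdot> q"
  using assms by (auto simp: is_pullback_def hom_def)

lemma is_pullback_lift:
  assumes "is_pullback C f g P p q"
    and "r \<in> Ar C" "s \<in> Ar C" "Dom C r = Dom C s" "Cod C r = Dom C f" "Cod C s = Dom C g"
    and "f \<cdot> r = g \<cdot> s"
  obtains u where "u \<in> Ar C" "Dom C u = Dom C r" "Cod C u = P" "p \<cdot> u = r" "q \<cdot> u = s"
proof -
  have "r \<in> hom C (Dom C r) (Dom C f)" "s \<in> hom C (Dom C r) (Dom C g)"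
    using assms by (simp_all add: hom_def)
  then have "\<exists>!u. u \<in> hom C (Dom C r) P \<and> p \<cdot> u = r \<and> q \<cdot> u = s"
    using assms(1,7) unfolding is_pullback_def by blast
  then show thesis using that by (auto simp: hom_def)
qed

lemma is_pullback_sym:
  assumes "is_pullback C f g P p q"
  shows "is_pullback C g f P q p"
  unfolding is_pullback_def
proof (intro conjI allI ballI impI)
  fix W r s
  assume "r \<in> hom C W (Dom C g)" "s \<in> hom C W (Dom C f)" "g \<cdot> r = f \<cdot> s"
  then have "\<exists>!u. u \<in> hom C W P \<and> p \<cdot> u = s \<and> q \<cdot> u = r"
    using assms unfolding is_pullback_def by metis
  then show "\<exists>!u. u \<in> hom C W P \<and> q \<cdot> u = r \<and> p \<cdot> u = s"
    by metis
qed (use is_pullbackD[OF assms] in \<open>auto simp: hom_def\<close>)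

section \<open>Sieves, their pullbacks, and sieves generated by morphisms\<close>

lemma sieveD:
  assumes "sieve C X S" "f \<in> S"
  shows "f \<in> Ar C" "Cod C f = X"
    "\<And>g. g \<in> Ar C \<Longrightarrow> Cod C g = Dom C f \<Longrightarrow> f \<cdot> g \<in> S"
  using assms by (auto simp: sieve_def)

lemma pullback_sieveD:
  assumes "g \<in> pullback_sieve C h S"
  shows "g \<in> Ar C" "Cod C g = Dom C h" "h \<cdot> g \<in> S"
  using assms by (simp_all add: pullback_sieve_def)

lemma sieve_pullback_sieve:
  assumes "sieve C X S" "h \<in> Ar C" "Cod C h = X"
  shows "sieve C (Dom C h) (pullback_sieve C h S)"
  using assms by (auto simp: sieve_def pullback_sieve_def simp flip: assoc)

lemma pullback_sieve_comp:
  assumes "h \<in> Ar C" "k \<in> Ar C" "Cod C k = Dom C h"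
  shows "pullback_sieve C k (pullback_sieve C h S) = pullback_sieve C (h \<cdot> k) S"
  using assms by (auto simp: pullback_sieve_def)

lemma pullback_sieve_Idn:
  assumes "sieve C X S" "X \<in> Ob C"
  shows "pullback_sieve C (Idn C X) S = S"
  using assms by (auto simp: pullback_sieve_def sieve_def)

lemma pullback_sieve_member:
  assumes "sieve C X S" "h \<in> S"
  shows "pullback_sieve C h S = {g \<in> Ar C. Cod C g = Dom C h}"
  using assms by (auto simp: pullback_sieve_def sieve_def)

lemma sieve_generated_sieve:
  assumes "\<And>f. f \<in> F \<Longrightarrow> f \<in> Ar C \<and> Cod C f = X"
  shows "sieve C X (generated_sieve C F)"
  unfolding sieve_def
proof (intro conjI ballI impI subsetI)
  fix k h assume "k \<in> generated_sieve C F" "h \<in> Ar C" "Cod C h = Dom C k"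
  then obtain f g where "k = f \<cdot> g" "f \<in> F" "g \<in> Ar C" "Cod C g = Dom C f"
    unfolding generated_sieve_def by blast
  moreover then have "k \<cdot> h = f \<cdot> (g \<cdot> h)" "g \<cdot> h \<in> Ar C" "Cod C (g \<cdot> h) = Dom C f"
    using assms[of f] \<open>h \<in> Ar C\<close> \<open>Cod C h = Dom C k\<close> by simp_all
  ultimately show "k \<cdot> h \<in> generated_sieve C F"
    unfolding generated_sieve_def by blast
qed (use assms in \<open>auto simp: generated_sieve_def\<close>)

lemma generator_mem_generated_sieve:
  assumes "f \<in> F" "f \<in> Ar C"
  shows "f \<in> generated_sieve C F"
proof -
  have "f = f \<cdot> Idn C (Dom C f)" "Idn C (Dom C f) \<in> Ar C" "Cod C (Idn C (Dom C f)) = Dom C f"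
    using assms by simp_all
  then show ?thesis using assms(1) unfolding generated_sieve_def by blast
qed

lemma generated_sieve_subset:
  assumes "sieve C X S" "F \<subseteq> S"
  shows "generated_sieve C F \<subseteq> S"
  using assms by (auto simp: generated_sieve_def sieve_def)

text \<open>By the universal property of the squares, \<open>g \<cdot> k\<close> factors through
  \<open>f i\<close> exactly when \<open>k\<close> factors through the projection
  \<open>q i\<close>. This turns pullbacks of families into pullbacks of sieves.\<close>

lemma pullback_generated_sieve:
  assumes pb: "\<And>i. i \<in> I \<Longrightarrow> is_pullback C (f i) g (P i) (p i) (q i)"
    and g: "g \<in> Ar C"
  shows "pullback_sieve C g (generated_sieve C (f ` I)) = generated_sieve C (q ` I)"
proof (intro equalityI subsetI)
  fix k assume "k \<in> pullback_sieve C g (generated_sieve C (f ` I))"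
  then obtain i m where k: "k \<in> Ar C" "Cod C k = Dom C g"
    and i: "i \<in> I" and m: "g \<cdot> k = f i \<cdot> m" "m \<in> Ar C" "Cod C m = Dom C (f i)"
    unfolding pullback_sieve_def generated_sieve_def by blast
  note pbi = is_pullbackD[OF pb[OF i]]
  \<comment> \<open>The lift requires \<open>m\<close> and \<open>k\<close> to have a common domain,
    which has to be read off the equation \<open>g \<cdot> k = f i \<cdot> m\<close>.\<close>
  have "Dom C m = Dom C (f i \<cdot> m)" using m pbi by simp
  also have "\<dots> = Dom C k" using m(1) k g by (metis comp_Ar(2))
  finally have "Dom C m = Dom C k" .
  then obtain u where "u \<in> Ar C" "Cod C u = P i" "q i \<cdot> u = k"
    using is_pullback_lift[OF pb[OF i] m(2) k(1)] k m by metis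
  then have "k = q i \<cdot> u" "u \<in> Ar C" "Cod C u = Dom C (q i)" using pbi by auto
  then show "k \<in> generated_sieve C (q ` I)"
    using i unfolding generated_sieve_def by blast
next
  fix k assume "k \<in> generated_sieve C (q ` I)"
  then obtain i m where i: "i \<in> I" and m: "k = q i \<cdot> m" "m \<in> Ar C" "Cod C m = Dom C (q i)"
    unfolding generated_sieve_def by blast
  note pbi = is_pullbackD[OF pb[OF i]]
  have "g \<cdot> k = (g \<cdot> q i) \<cdot> m" using m pbi by simp
  also have "\<dots> = f i \<cdot> (p i \<cdot> m)" using m pbi by (simp flip: pbi(10))
  finally have "g \<cdot> k = f i \<cdot> (p i \<cdot> m)" .
  moreover have "p i \<cdot> m \<in> Ar C" "Cod C (p i \<cdot> m) = Dom C (f i)" using m pbi by simp_all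
  ultimately have "g \<cdot> k \<in> generated_sieve C (f ` I)"
    using i unfolding generated_sieve_def by blast
  then show "k \<in> pullback_sieve C g (generated_sieve C (f ` I))"
    using m pbi by (simp add: pullback_sieve_def)
qed

end

section \<open>Universally effective sieves form the canonical topology\<close>

text \<open>For a sieve \<open>S\<close> on \<open>X\<close>, this is a natural transformation from
  \<open>S\<close>, seen as a subfunctor of hom(-, X), to hom(-, Z). It has the form of the
  compatibility premise of \<open>is_sheaf\<close>.\<close>

definition matching_family ::
  "('o, 'a) cat \<Rightarrow> 'a set \<Rightarrow> 'o \<Rightarrow> ('a \<Rightarrow> 'a) \<Rightarrow> bool" where
  "matching_family C S Z x \<longleftrightarrow>
    (\<forall>f\<in>S. x f \<in> hom C (Dom C f) Z) \<and>
    (\<forall>f\<in>S. \<forall>g\<in>Ar C. Cod C g = Dom C f \<longrightarrow> x f \<cdot>\<^bsub>C\<^esub> g = x (f \<cdot>\<^bsub>C\<^esub> g))"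

text \<open>For a sieve \<open>S\<close> this says that \<open>X\<close>, with the members of
  \<open>S\<close> as legs, is the colimit of their domains.\<close>

definition effective_sieve :: "('o, 'a) cat \<Rightarrow> 'o \<Rightarrow> 'a set \<Rightarrow> bool" where
  "effective_sieve C X S \<longleftrightarrow>
    (\<forall>Z\<in>Ob C. \<forall>x. matching_family C S Z x \<longrightarrow>
      (\<exists>!s. s \<in> hom C X Z \<and> (\<forall>f\<in>S. s \<cdot>\<^bsub>C\<^esub> f = x f)))"

definition universally_effective_sieves :: "('o, 'a) cat \<Rightarrow> 'o \<Rightarrow> 'a set set" where
  "universally_effective_sieves C X = {S. sieve C X S \<and>
    (\<forall>h\<in>Ar C. Cod C h = X \<longrightarrow> effective_sieve C (Dom C h) (pullback_sieve C h S))}"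

context category
begin

section \<open>Gluing along effective sieves, and locality\<close>

lemma matching_familyD:
  assumes "matching_family C S Z x" "f \<in> S"
  shows "x f \<in> Ar C" "Dom C (x f) = Dom C f" "Cod C (x f) = Z"
    "\<And>g. g \<in> Ar C \<Longrightarrow> Cod C g = Dom C f \<Longrightarrow> x f \<cdot> g = x (f \<cdot> g)"
  using assms by (auto simp: matching_family_def hom_def)

lemma effective_sieveI:
  assumes "\<And>Z x. Z \<in> Ob C \<Longrightarrow> matching_family C S Z x \<Longrightarrow>
      \<exists>s\<in>hom C X Z. \<forall>f\<in>S. s \<cdot> f = x f"
    and "\<And>Z s t. Z \<in> Ob C \<Longrightarrow> s \<in> hom C X Z \<Longrightarrow> t \<in> hom C X Z \<Longrightarrow>
      \<forall>f\<in>S. s \<cdot> f = t \<cdot> f \<Longrightarrow> s = t"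
  shows "effective_sieve C X S"
  unfolding effective_sieve_def
proof (intro ballI allI impI)
  fix Z x assume Z: "Z \<in> Ob C" and x: "matching_family C S Z x"
  from assms(1)[OF Z x] obtain s where "s \<in> hom C X Z" "\<forall>f\<in>S. s \<cdot> f = x f" by blast
  then show "\<exists>!s. s \<in> hom C X Z \<and> (\<forall>f\<in>S. s \<cdot> f = x f)"
    using assms(2)[OF Z] by (intro ex1I[of _ s]) auto
qed

lemma effective_sieve_glue:
  assumes "effective_sieve C X S" "Z \<in> Ob C" "matching_family C S Z x"
  obtains s where "s \<in> Ar C" "Dom C s = X" "Cod C s = Z" "\<And>f. f \<in> S \<Longrightarrow> s \<cdot> f = x f"
proof -
  have "\<exists>!s. s \<in> hom C X Z \<and> (\<forall>f\<in>S. s \<cdot> f = x f)"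
    using assms unfolding effective_sieve_def by blast
  then show thesis using that by (auto simp: hom_def)
qed

text \<open>Both \<open>s\<close> and \<open>t\<close> glue the matching family sending
  \<open>f\<close> to \<open>s \<cdot> f\<close>.\<close>

lemma effective_sieve_unique:
  assumes "effective_sieve C X S" "sieve C X S"
    and "s \<in> Ar C" "t \<in> Ar C" "Dom C s = X" "Dom C t = X" "Cod C s = Cod C t"
    and "\<And>f. f \<in> S \<Longrightarrow> s \<cdot> f = t \<cdot> f"
  shows "s = t"
proof -
  have "matching_family C S (Cod C s) (\<lambda>f. s \<cdot> f)"
    using assms by (auto simp: matching_family_def hom_def sieve_def)
  then have "\<exists>!r. r \<in> hom C X (Cod C s) \<and> (\<forall>f\<in>S. r \<cdot> f = s \<cdot> f)"
    using assms(1) \<open>s \<in> Ar C\<close> unfolding effective_sieve_def by simp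
  then show "s = t" using assms by (metis homI)
qed

lemma universally_effective_sievesD:
  assumes "S \<in> universally_effective_sieves C X"
  shows "sieve C X S"
    "\<And>h. h \<in> Ar C \<Longrightarrow> Cod C h = X \<Longrightarrow> effective_sieve C (Dom C h) (pullback_sieve C h S)"
  using assms by (simp_all add: universally_effective_sieves_def)

text \<open>Pulling back along the identity of \<open>X\<close> returns \<open>S\<close>.\<close>

lemma universally_effective_sieve_effective:
  assumes "S \<in> universally_effective_sieves C X" "X \<in> Ob C"
  shows "effective_sieve C X S"
  using universally_effective_sievesD[OF assms(1)] pullback_sieve_Idn assms(2)
  by (metis Idn_Ar)

lemma universally_effective_pullback_sieve:
  assumes "S \<in> universally_effective_sieves C X" "h \<in> Ar C" "Cod C h = X"
  shows "pullback_sieve C h S \<in> universally_effective_sieves C (Dom C h)"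
  unfolding universally_effective_sieves_def
proof (intro CollectI conjI ballI impI)
  show "sieve C (Dom C h) (pullback_sieve C h S)"
    using sieve_pullback_sieve[OF universally_effective_sievesD(1)] assms by blast
  fix k assume "k \<in> Ar C" "Cod C k = Dom C h"
  then show "effective_sieve C (Dom C k) (pullback_sieve C k (pullback_sieve C h S))"
    using universally_effective_sievesD(2)[OF assms(1), of "h \<cdot> k"] assms(2,3)
    by (simp add: pullback_sieve_comp)
qed

text \<open>This is the Yoneda lemma: a matching family on all morphisms into \<open>X\<close> is
  determined by its value at the identity.\<close>

lemma effective_maximal_sieve:
  assumes "X \<in> Ob C"
  shows "effective_sieve C X {f \<in> Ar C. Cod C f = X}"
proof (rule effective_sieveI)
  fix Z x assume x: "matching_family C {f \<in> Ar C. Cod C f = X} Z x"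
  have id: "Idn C X \<in> {f \<in> Ar C. Cod C f = X}" using assms by simp
  note xD = matching_familyD[OF x id]
  show "\<exists>s\<in>hom C X Z. \<forall>f\<in>{f \<in> Ar C. Cod C f = X}. s \<cdot> f = x f"
    using xD assms by (intro bexI[of _ "x (Idn C X)"]) (auto simp: hom_def)
next
  fix Z s t assume "s \<in> hom C X Z" "t \<in> hom C X Z"
    and "\<forall>f\<in>{f \<in> Ar C. Cod C f = X}. s \<cdot> f = t \<cdot> f"
  then have "s \<cdot> Idn C X = t \<cdot> Idn C X" using assms by simp
  then show "s = t" using \<open>s \<in> hom C X Z\<close> \<open>t \<in> hom C X Z\<close> by (simp add: hom_def)
qed

lemma universally_effective_maximal_sieve:
  assumes "X \<in> Ob C"
  shows "{f \<in> Ar C. Cod C f = X} \<in> universally_effective_sieves C X"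
  unfolding universally_effective_sieves_def
proof (intro CollectI conjI ballI impI)
  show s: "sieve C X {f \<in> Ar C. Cod C f = X}" by (auto simp: sieve_def)
  fix h assume "h \<in> Ar C" "Cod C h = X"
  then show "effective_sieve C (Dom C h) (pullback_sieve C h {f \<in> Ar C. Cod C f = X})"
    using pullback_sieve_member[OF s] effective_maximal_sieve by simp
qed

text \<open>Gluing proceeds in two stages: a matching family on \<open>R\<close> is glued over each
  \<open>h\<close> in \<open>S\<close>, and the results are glued along \<open>S\<close>. Every
  equality of morphisms is checked locally, on a suitable effective pullback sieve.\<close>

lemma effective_sieve_transitive:
  assumes X: "X \<in> Ob C"
    and S: "S \<in> universally_effective_sieves C X"
    and R: "sieve C X R"
    and loc: "\<And>h. h \<in> S \<Longrightarrow>
      pullback_sieve C h R \<in> universally_effective_sieves C (Dom C h)"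
  shows "effective_sieve C X R"
proof (rule effective_sieveI)
  have sS: "sieve C X S" using S by (simp add: universally_effective_sieves_def)
  note SD = sieveD[OF sS] and RD = sieveD[OF R]
  have effS: "effective_sieve C X S"
    using universally_effective_sieve_effective[OF S X] .
  have eff: "effective_sieve C (Dom C h) (pullback_sieve C h R)" if "h \<in> S" for h
    using universally_effective_sieve_effective[OF loc[OF that]] SD[OF that] by simp
  have sv: "sieve C (Dom C h) (pullback_sieve C h R)" if "h \<in> S" for h
    using sieve_pullback_sieve[OF R] SD[OF that] by simp
  {
    fix Z s t assume "s \<in> hom C X Z" "t \<in> hom C X Z" and eq: "\<forall>f\<in>R. s \<cdot> f = t \<cdot> f"
    then have st: "s \<in> Ar C" "Dom C s = X" "Cod C s = Z" "t \<in> Ar C" "Dom C t = X" "Cod C t = Z"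
      by (simp_all add: hom_def)
    \<comment> \<open>Agreement on \<open>R\<close> gives agreement after each \<open>h\<close> in
      \<open>S\<close>, because the pullback of \<open>R\<close> along \<open>h\<close> is
      effective; effectiveness of \<open>S\<close> then gives \<open>s = t\<close>.\<close>
    have "s \<cdot> h = t \<cdot> h" if h: "h \<in> S" for h
    proof (rule effective_sieve_unique[OF eff[OF h] sv[OF h]])
      fix g assume "g \<in> pullback_sieve C h R"
      then show "s \<cdot> h \<cdot> g = t \<cdot> h \<cdot> g"
        using st SD[OF h] eq by (simp add: pullback_sieve_def)
    qed (use st SD[OF h] in simp_all)
    then show "s = t"
      using effective_sieve_unique[OF effS sS] st by metis
  }
  fix Z x assume Z: "Z \<in> Ob C" and x: "matching_family C R Z x"
  note xD = matching_familyD[OF x]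
  \<comment> \<open>First stage: restricting \<open>x\<close> along \<open>h\<close> is a matching
    family on the pullback of \<open>R\<close>, and \<open>y h\<close> is its gluing.\<close>
  have "\<exists>y. y \<in> hom C (Dom C h) Z \<and> (\<forall>g\<in>pullback_sieve C h R. y \<cdot> g = x (h \<cdot> g))"
    if h: "h \<in> S" for h
  proof -
    have "matching_family C (pullback_sieve C h R) Z (\<lambda>g. x (h \<cdot> g))"
      using SD[OF h] xD unfolding matching_family_def hom_def pullback_sieve_def by auto
    from effective_sieve_glue[OF eff[OF h] Z this] show ?thesis
      by (metis homI)
  qed
  then obtain y where "\<forall>h\<in>S. y h \<in> hom C (Dom C h) Z \<and>
      (\<forall>g\<in>pullback_sieve C h R. y h \<cdot> g = x (h \<cdot> g))"
    by metis
  then have y: "y h \<in> Ar C" "Dom C (y h) = Dom C h" "Cod C (y h) = Z"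
      "\<And>g. g \<in> pullback_sieve C h R \<Longrightarrow> y h \<cdot> g = x (h \<cdot> g)" if "h \<in> S" for h
    using that by (simp_all add: hom_def)
  have "matching_family C S Z y"
    unfolding matching_family_def
  proof (intro conjI ballI impI)
    fix h l assume h: "h \<in> S" and l: "l \<in> Ar C" "Cod C l = Dom C h"
    have hl: "h \<cdot> l \<in> S" using SD(3)[OF h l] .
    show "y h \<cdot> l = y (h \<cdot> l)"
    \<comment> \<open>After any \<open>m\<close> in the pullback of \<open>R\<close> along
      \<open>h \<cdot> l\<close>, both sides become \<open>x\<close> of the composite of
      \<open>h\<close>, \<open>l\<close> and \<open>m\<close>.\<close>
    proof (rule effective_sieve_unique[OF eff[OF hl] sv[OF hl]])
      fix m assume m: "m \<in> pullback_sieve C (h \<cdot> l) R"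
      note mD = pullback_sieveD[OF m]
      have "l \<cdot> m \<in> pullback_sieve C h R"
        using mD SD(1,2)[OF h] l by (simp add: pullback_sieve_def)
      then have "y h \<cdot> (l \<cdot> m) = x (h \<cdot> (l \<cdot> m))" by (rule y(4)[OF h])
      then show "y h \<cdot> l \<cdot> m = y (h \<cdot> l) \<cdot> m"
        using mD y(1-3)[OF h] y(4)[OF hl m] SD(1,2)[OF h] l by simp
    qed (use y[OF h] y[OF hl] SD[OF h] l in simp_all)
  qed (use y in \<open>auto simp: hom_def\<close>)
  then obtain s where s: "s \<in> Ar C" "Dom C s = X" "Cod C s = Z" "\<And>h. h \<in> S \<Longrightarrow> s \<cdot> h = y h"
    using effective_sieve_glue[OF effS Z] by blast
  \<comment> \<open>The gluing \<open>s\<close> is controlled on \<open>S\<close> only, so the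
    equation is tested on the pullback of \<open>S\<close> along \<open>r\<close>. This is where the
    universal effectiveness of \<open>S\<close> enters.\<close>
  have "s \<cdot> r = x r" if r: "r \<in> R" for r
  proof (rule effective_sieve_unique)
    note rD = RD[OF r]
    show "effective_sieve C (Dom C r) (pullback_sieve C r S)"
      using S rD by (simp add: universally_effective_sieves_def)
    show "sieve C (Dom C r) (pullback_sieve C r S)"
      using sieve_pullback_sieve[OF sS] rD by simp
    fix m assume "m \<in> pullback_sieve C r S"
    then have m: "m \<in> Ar C" "Cod C m = Dom C r" "r \<cdot> m \<in> S"
      by (simp_all add: pullback_sieve_def)
    have rm: "r \<cdot> m \<in> R" using rD m by simp
    \<comment> \<open>Since \<open>r \<cdot> m\<close> lies in both sieves, the defining property of
      \<open>y\<close> may be evaluated at an identity, which yields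
      \<open>y (r \<cdot> m) = x (r \<cdot> m)\<close>.\<close>
    then have "Idn C (Dom C m) \<in> pullback_sieve C (r \<cdot> m) R"
      using rD m by (simp add: pullback_sieve_def)
    from y(4)[OF m(3) this] have "y (r \<cdot> m) = x (r \<cdot> m)"
      using y[OF m(3)] m rD by simp
    then show "s \<cdot> r \<cdot> m = x r \<cdot> m"
      using s m rD xD(4)[OF r] by simp
  qed (use s RD[OF r] xD[OF r] in simp_all)
  then show "\<exists>s\<in>hom C X Z. \<forall>f\<in>R. s \<cdot> f = x f"
    using s by (auto simp: hom_def)
qed

text \<open>The hypotheses of the preceding lemma are stable under pullback along any
  \<open>k\<close>, since iterated pullbacks of a sieve are pullbacks along composites.\<close>

lemma universally_effective_transitive:
  assumes S: "S \<in> universally_effective_sieves C X"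
    and R: "sieve C X R"
    and loc: "\<And>h. h \<in> S \<Longrightarrow>
      pullback_sieve C h R \<in> universally_effective_sieves C (Dom C h)"
  shows "R \<in> universally_effective_sieves C X"
  unfolding universally_effective_sieves_def
proof (intro CollectI conjI ballI impI)
  fix k assume k: "k \<in> Ar C" "Cod C k = X"
  show "effective_sieve C (Dom C k) (pullback_sieve C k R)"
  proof (rule effective_sieve_transitive)
    show "pullback_sieve C k S \<in> universally_effective_sieves C (Dom C k)"
      using universally_effective_pullback_sieve[OF S] k by simp
    show "sieve C (Dom C k) (pullback_sieve C k R)"
      using sieve_pullback_sieve[OF R] k by simp
    fix h assume "h \<in> pullback_sieve C k S"
    note hD = pullback_sieveD[OF this]
    show "pullback_sieve C h (pullback_sieve C k R) \<in> universally_effective_sieves C (Dom C h)"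
      using loc[OF hD(3)] hD(1,2) k by (simp add: pullback_sieve_comp)
  qed (use k in simp)
qed (rule R)

text \<open>Transitivity applies because \<open>R\<close> pulls back to the maximal sieve along each
  member of \<open>S\<close>.\<close>

lemma universally_effective_superset:
  assumes S: "S \<in> universally_effective_sieves C X" and R: "sieve C X R" and "S \<subseteq> R"
  shows "R \<in> universally_effective_sieves C X"
proof (rule universally_effective_transitive[OF S R])
  fix h assume "h \<in> S"
  then have "h \<in> R" using assms by blast
  then show "pullback_sieve C h R \<in> universally_effective_sieves C (Dom C h)"
    using pullback_sieve_member[OF R] universally_effective_maximal_sieve sieveD[OF R] by simp
qed

section \<open>The canonical topology as the largest subcanonical one\<close>

lemma subcanonical_iff_effective:
  "subcanonical_topology C T \<longleftrightarrow>
    grothendieck_topology C T \<and> (\<forall>X\<in>Ob C. \<forall>S\<in>T X. effective_sieve C X S)"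
proof -
  \<comment> \<open>With the sheaf condition for a single \<open>Z\<close> abbreviated, both sides
    differ only in the order of the quantifiers over \<open>Z\<close> and over the covers.\<close>
  define P where "P X S Z \<longleftrightarrow> (\<forall>x. matching_family C S Z x \<longrightarrow>
      (\<exists>!s. s \<in> hom C X Z \<and> (\<forall>f\<in>S. s \<cdot> f = x f)))" for X S Z
  have sheaf: "is_sheaf C T (\<lambda>X. hom C X Z) (\<lambda>g s. s \<cdot> g) \<longleftrightarrow> (\<forall>X\<in>Ob C. \<forall>S\<in>T X. P X S Z)" for Z
    unfolding is_sheaf_def matching_family_def P_def ..
  have eff: "effective_sieve C X S \<longleftrightarrow> (\<forall>Z\<in>Ob C. P X S Z)" for X S
    unfolding effective_sieve_def P_def ..
  show ?thesis unfolding subcanonical_topology_def sheaf eff by blast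
qed

text \<open>A topology contains all pullbacks of its covers, so effectiveness of covers is
  automatically universal.\<close>

lemma subcanonical_subset_universally_effective:
  assumes "subcanonical_topology C T" "X \<in> Ob C"
  shows "T X \<subseteq> universally_effective_sieves C X"
proof
  fix S assume S: "S \<in> T X"
  have T: "grothendieck_topology C T"
    and eff: "\<And>Y R. Y \<in> Ob C \<Longrightarrow> R \<in> T Y \<Longrightarrow> effective_sieve C Y R"
    using assms(1) by (simp_all add: subcanonical_iff_effective)
  show "S \<in> universally_effective_sieves C X"
    unfolding universally_effective_sieves_def
  proof (intro CollectI conjI ballI impI)
    show "sieve C X S" using T S assms(2) unfolding grothendieck_topology_def by blast
    fix h assume h: "h \<in> Ar C" "Cod C h = X"
    then have "pullback_sieve C h S \<in> T (Dom C h)"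
      using T S assms(2) unfolding grothendieck_topology_def by blast
    then show "effective_sieve C (Dom C h) (pullback_sieve C h S)"
      using eff h by simp
  qed
qed

lemma canonical_topology_universally_effective:
  "canonical_topology C (universally_effective_sieves C)"
proof -
  have "grothendieck_topology C (universally_effective_sieves C)"
    unfolding grothendieck_topology_def
  proof (intro conjI ballI allI impI)
    fix X S assume "X \<in> Ob C" "S \<in> universally_effective_sieves C X"
    then show "sieve C X S" by (simp add: universally_effective_sieves_def)
  next
    fix X S R assume "S \<in> universally_effective_sieves C X"
      and "sieve C X R \<and>
        (\<forall>h\<in>S. pullback_sieve C h R \<in> universally_effective_sieves C (Dom C h))"
    then show "R \<in> universally_effective_sieves C X"
      using universally_effective_transitive by blast
  qed (simp_all add: universally_effective_maximal_sieve universally_effective_pullback_sieve)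
  then have "subcanonical_topology C (universally_effective_sieves C)"
    unfolding subcanonical_iff_effective using universally_effective_sieve_effective by blast
  then show ?thesis
    unfolding canonical_topology_def
    using subcanonical_subset_universally_effective by blast
qed

section \<open>Effective epimorphisms and coproducts\<close>

text \<open>A matching family \<open>x\<close> is determined by \<open>x f\<close>, which
  coequalizes the kernel pair of \<open>f\<close> because \<open>f \<cdot> p = f \<cdot> q\<close>;
  it therefore descends along \<open>f\<close>.\<close>

lemma effective_epi_imp_effective_sieve:
  assumes "effective_epi C f"
  shows "effective_sieve C (Cod C f) (generated_sieve C {f})"
proof (rule effective_sieveI)
  obtain P p q Q c u where epi: "is_epi C f" and pb: "is_pullback C f f P p q"
    and cq: "is_coequalizer C p q Q c"
    and u: "u \<in> hom C Q (Cod C f)" "u \<cdot> c = f" "is_iso C u"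
    using assms unfolding effective_epi_def by blast
  note pbD = is_pullbackD[OF pb] and uD = homD[OF u(1)]
  have c: "c \<in> Ar C" "Dom C c = Dom C f" "Cod C c = Q"
    using cq pbD unfolding is_coequalizer_def by (simp_all add: hom_def)
  have f: "f \<in> generated_sieve C {f}" using generator_mem_generated_sieve pbD by simp
  obtain v where v: "v \<in> Ar C" "Dom C v = Cod C f" "Cod C v = Q" "v \<cdot> u = Idn C Q"
    using u(3) uD unfolding is_iso_def by (auto simp: hom_def)
  {
    fix Z x assume x: "matching_family C (generated_sieve C {f}) Z x"
    note xf = matching_familyD[OF x f]
    have "x f \<cdot> p = x f \<cdot> q" using xf(4) pbD by simp
    moreover have "x f \<in> hom C (Cod C p) Z" using xf pbD by (simp add: hom_def)
    ultimately have "\<exists>!w. w \<in> hom C Q Z \<and> w \<cdot> c = x f"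
      using cq unfolding is_coequalizer_def by blast
    then obtain w where w: "w \<in> Ar C" "Dom C w = Q" "Cod C w = Z" "w \<cdot> c = x f"
      by (auto simp: hom_def)
    \<comment> \<open>The factorization \<open>w\<close> starts at the chosen coequalizer
      \<open>Q\<close>; the inverse \<open>v\<close> of the comparison map moves it to the codomain
      of \<open>f\<close>.\<close>
    have "v \<cdot> f = c"
    proof -
      have "v \<cdot> f = (v \<cdot> u) \<cdot> c" using v(1-3) uD c u(2) by simp
      then show ?thesis using v(4) c by simp
    qed
    then have "(w \<cdot> v) \<cdot> f = x f" using w v pbD by simp
    then have "(w \<cdot> v) \<cdot> (f \<cdot> g) = x (f \<cdot> g)" if "g \<in> Ar C" "Cod C g = Dom C f" for g
      using that w v pbD xf(4)[OF that] by (simp flip: assoc)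
    then show "\<exists>s\<in>hom C (Cod C f) Z. \<forall>k\<in>generated_sieve C {f}. s \<cdot> k = x k"
      using w v by (intro bexI[of _ "w \<cdot> v"]) (auto simp: generated_sieve_def hom_def)
  next
    fix Z s t assume "s \<in> hom C (Cod C f) Z" "t \<in> hom C (Cod C f) Z"
      "\<forall>k\<in>generated_sieve C {f}. s \<cdot> k = t \<cdot> k"
    then show "s = t" using epi f unfolding is_epi_def by blast
  }
qed

text \<open>A morphism \<open>d\<close> that coequalizes the kernel pair defines a matching family
  \<open>f \<cdot> g \<mapsto> d \<cdot> g\<close>. Gluing it exhibits \<open>f\<close> itself as
  the coequalizer, with the identity as comparison map.\<close>

lemma effective_sieve_imp_effective_epi:
  assumes f: "f \<in> Ar C" and "has_pullbacks C"
    and eff: "effective_sieve C (Cod C f) (generated_sieve C {f})"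
  shows "effective_epi C f"
proof -
  let ?S = "generated_sieve C {f}"
  have sv: "sieve C (Cod C f) ?S" using f by (intro sieve_generated_sieve) auto
  have fS: "f \<in> ?S" using generator_mem_generated_sieve f by simp
  have uniq: "s = t"
    if "s \<in> hom C (Cod C f) Z" "t \<in> hom C (Cod C f) Z" "s \<cdot> f = t \<cdot> f" for s t Z
  proof (rule effective_sieve_unique[OF eff sv])
    fix k assume "k \<in> ?S"
    then obtain g where "k = f \<cdot> g" "g \<in> Ar C" "Cod C g = Dom C f"
      unfolding generated_sieve_def by blast
    then show "s \<cdot> k = t \<cdot> k" using that f by (simp add: hom_def flip: assoc)
  qed (use that in \<open>simp_all add: hom_def\<close>)
  then have epi: "is_epi C f" unfolding is_epi_def using f by blast
  obtain P p q where pb: "is_pullback C f f P p q"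
    using assms unfolding has_pullbacks_def by blast
  note pbD = is_pullbackD[OF pb]
  have "is_coequalizer C p q (Cod C f) f"
    unfolding is_coequalizer_def
  proof (intro conjI allI ballI impI)
    fix Z d assume "d \<in> hom C (Cod C p) Z" and eq: "d \<cdot> p = d \<cdot> q"
    then have d: "d \<in> Ar C" "Dom C d = Dom C f" "Cod C d = Z"
      using pbD by (simp_all add: hom_def)
    \<comment> \<open>Independence of the chosen factorization: two factorizations of one morphism
      through \<open>f\<close> form a single morphism into the kernel pair.\<close>
    have wd: "d \<cdot> g = d \<cdot> h"
      if g: "g \<in> Ar C" "Cod C g = Dom C f" and h: "h \<in> Ar C" "Cod C h = Dom C f"
        and gh: "f \<cdot> g = f \<cdot> h" for g h
    proof -
      have "Dom C g = Dom C h" using g h gh f by (metis comp_Ar(2))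
      then obtain u where u: "u \<in> Ar C" "Cod C u = P" "p \<cdot> u = g" "q \<cdot> u = h"
        using is_pullback_lift[OF pb g(1) h(1) _ g(2) h(2) gh] by blast
      then have "d \<cdot> g = (d \<cdot> p) \<cdot> u" "d \<cdot> h = (d \<cdot> q) \<cdot> u" using d pbD by auto
      then show ?thesis using eq by simp
    qed
    define x where "x k = d \<cdot> (SOME g. g \<in> Ar C \<and> Cod C g = Dom C f \<and> k = f \<cdot> g)" for k
    have x: "x (f \<cdot> g) = d \<cdot> g" if "g \<in> Ar C" "Cod C g = Dom C f" for g
    proof -
      let ?h = "SOME h. h \<in> Ar C \<and> Cod C h = Dom C f \<and> f \<cdot> g = f \<cdot> h"
      have "?h \<in> Ar C \<and> Cod C ?h = Dom C f \<and> f \<cdot> g = f \<cdot> ?h"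
        by (rule someI[of _ g]) (use that in simp)
      then show ?thesis unfolding x_def using wd[of ?h g] that by simp
    qed
    have "matching_family C ?S Z x"
      unfolding matching_family_def generated_sieve_def
      using x d f by (auto simp: hom_def)
    then obtain s where s: "s \<in> Ar C" "Dom C s = Cod C f" "Cod C s = Z" "\<And>k. k \<in> ?S \<Longrightarrow> s \<cdot> k = x k"
      using effective_sieve_glue[OF eff] d by (metis cod_Ob)
    have "s \<cdot> f = d"
      using s(4)[OF fS] x[of "Idn C (Dom C f)"] f d by simp
    then show "\<exists>!s. s \<in> hom C (Cod C f) Z \<and> s \<cdot> f = d"
      using s uniq by (intro ex1I[of _ s]) (auto simp: hom_def)
  qed (use pbD in \<open>auto simp: hom_def\<close>)
  moreover have "is_iso C (Idn C (Cod C f))"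
    using f by (auto simp: is_iso_def hom_def intro!: bexI[of _ "Idn C (Cod C f)"])
  ultimately show ?thesis
    unfolding effective_epi_def using epi pb f idn_hom
    by (metis Idn_comp cod_Ob)
qed

text \<open>The two preceding lemmas are applied to every pullback of \<open>f\<close>, since the
  sieve of \<open>f\<close> pulls back to the sieve of the projection.\<close>

lemma universal_effective_epi_iff:
  assumes f: "f \<in> Ar C" and pbs: "has_pullbacks C"
  shows "universal_effective_epi C f \<longleftrightarrow>
    generated_sieve C {f} \<in> universally_effective_sieves C (Cod C f)"
proof
  have pull: "pullback_sieve C g (generated_sieve C {f}) = generated_sieve C {q}"
    if "is_pullback C f g P p q" for g P p q
    using pullback_generated_sieve[of "{()}" "\<lambda>_. f" g "\<lambda>_. P" "\<lambda>_. p" "\<lambda>_. q"]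
      is_pullbackD[OF that] that by simp
  {
    assume u: "universal_effective_epi C f"
    show "generated_sieve C {f} \<in> universally_effective_sieves C (Cod C f)"
      unfolding universally_effective_sieves_def
    proof (intro CollectI conjI ballI impI)
      show "sieve C (Cod C f) (generated_sieve C {f})"
        using f by (intro sieve_generated_sieve) auto
      fix g assume "g \<in> Ar C" "Cod C g = Cod C f"
      then obtain P p q where pb: "is_pullback C f g P p q"
        using pbs f unfolding has_pullbacks_def by metis
      then have "effective_epi C q" using u unfolding universal_effective_epi_def by blast
      then show "effective_sieve C (Dom C g) (pullback_sieve C g (generated_sieve C {f}))"
        using effective_epi_imp_effective_sieve pull[OF pb] is_pullbackD[OF pb] by metis
    qed
  next
    assume u: "generated_sieve C {f} \<in> universally_effective_sieves C (Cod C f)"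
    show "universal_effective_epi C f"
      unfolding universal_effective_epi_def
    proof (intro conjI allI impI)
      show "effective_epi C f"
        using effective_sieve_imp_effective_epi[OF f pbs]
          universally_effective_sieve_effective[OF u] f by simp
      fix g P p q assume pb: "is_pullback C f g P p q"
      note pbD = is_pullbackD[OF pb]
      have "effective_sieve C (Cod C q) (generated_sieve C {q})"
        using u pull[OF pb] pbD unfolding universally_effective_sieves_def by auto
      then show "effective_epi C q"
        using effective_sieve_imp_effective_epi pbs pbD by simp
    qed
  }
qed

section \<open>Coproduct inclusions and the sieves they generate\<close>

lemma is_coproductD:
  assumes "is_coproduct C I A E inc"
  shows "E \<in> Ob C" "\<And>i. i \<in> I \<Longrightarrow> inc i \<in> Ar C" "\<And>i. i \<in> I \<Longrightarrow> Dom C (inc i) = A i"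
    "\<And>i. i \<in> I \<Longrightarrow> Cod C (inc i) = E"
  using assms by (auto simp: is_coproduct_def hom_def)

lemma is_coproduct_ex1:
  assumes "is_coproduct C I A E inc" "Z \<in> Ob C" "\<And>i. i \<in> I \<Longrightarrow> h i \<in> hom C (A i) Z"
  shows "\<exists>!u. u \<in> hom C E Z \<and> (\<forall>i\<in>I. u \<cdot> inc i = h i)"
  using assms unfolding is_coproduct_def by blast

text \<open>Maps out of the new object arise by composing with the inverse of \<open>u\<close>. This
  turns the comparison isomorphism of a stable coproduct into a coproduct structure on the object
  that it maps to.\<close>

lemma is_coproduct_iso:
  assumes cp: "is_coproduct C I A E inc" and iso: "is_iso C u" and dom: "Dom C u = E"
  shows "is_coproduct C I A (Cod C u) (\<lambda>i. u \<cdot> inc i)"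
  unfolding is_coproduct_def
proof (intro conjI ballI allI impI)
  note cpD = is_coproductD[OF cp]
  have u: "u \<in> Ar C" using iso by (simp add: is_iso_def)
  obtain v where v: "v \<in> Ar C" "Dom C v = Cod C u" "Cod C v = E"
      "v \<cdot> u = Idn C E" "u \<cdot> v = Idn C (Cod C u)"
    using iso dom unfolding is_iso_def by (auto simp: hom_def)
  show "Cod C u \<in> Ob C" using u by simp
  {
    fix i assume "i \<in> I"
    then show "A i \<in> Ob C" using cp by (simp add: is_coproduct_def)
    show "u \<cdot> inc i \<in> hom C (A i) (Cod C u)"
      using cpD \<open>i \<in> I\<close> u dom by (simp add: hom_def)
  }
  fix Z h assume Z: "Z \<in> Ob C" and h: "\<forall>i\<in>I. h i \<in> hom C (A i) Z"
  have ex1: "\<exists>!w. w \<in> hom C E Z \<and> (\<forall>i\<in>I. w \<cdot> inc i = h i)"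
    using is_coproduct_ex1[OF cp Z] h by blast
  then obtain w where w: "w \<in> Ar C" "Dom C w = E" "Cod C w = Z" "\<And>i. i \<in> I \<Longrightarrow> w \<cdot> inc i = h i"
    by (auto simp: hom_def)
  show "\<exists>!w. w \<in> hom C (Cod C u) Z \<and> (\<forall>i\<in>I. w \<cdot> (u \<cdot> inc i) = h i)"
  proof (rule ex1I[of _ "w \<cdot> v"])
    have "w \<cdot> v \<cdot> (u \<cdot> inc i) = h i" if "i \<in> I" for i
    proof -
      have "v \<cdot> (u \<cdot> inc i) = (v \<cdot> u) \<cdot> inc i"
        using that v(1-3) u dom cpD by simp
      also have "\<dots> = inc i" using that v(4) cpD by simp
      finally show ?thesis using that w v(1-3) u dom cpD by simp
    qed
    then show "w \<cdot> v \<in> hom C (Cod C u) Z \<and> (\<forall>i\<in>I. w \<cdot> v \<cdot> (u \<cdot> inc i) = h i)"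
      using w v by (simp add: hom_def)
    fix t assume t: "t \<in> hom C (Cod C u) Z \<and> (\<forall>i\<in>I. t \<cdot> (u \<cdot> inc i) = h i)"
    then have "t \<cdot> u \<in> hom C E Z \<and> (\<forall>i\<in>I. t \<cdot> u \<cdot> inc i = h i)"
      using u dom cpD by (auto simp: hom_def)
    then have "t \<cdot> u = w" using ex1 w by (metis homI)
    moreover have "(t \<cdot> u) \<cdot> v = t \<cdot> (u \<cdot> v)" using u v(1-3) dom t by (simp add: hom_def)
    ultimately show "t = w \<cdot> v" using v(5) t by (simp add: hom_def)
  qed
qed

text \<open>The copairing of the values at the inclusions is the gluing: every other member is some
  \<open>inc i \<cdot> g\<close>, where matching forces the value
  \<open>x (inc i) \<cdot> g\<close>.\<close>

lemma effective_sieve_coproduct: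
  assumes cp: "is_coproduct C I A E inc"
  shows "effective_sieve C E (generated_sieve C (inc ` I))"
proof (rule effective_sieveI)
  note cpD = is_coproductD[OF cp]
  have inc: "inc i \<in> generated_sieve C (inc ` I)" if "i \<in> I" for i
    using that generator_mem_generated_sieve cpD by simp
  {
    fix Z x assume Z: "Z \<in> Ob C" and x: "matching_family C (generated_sieve C (inc ` I)) Z x"
    note xD = matching_familyD[OF x inc]
    have "\<exists>!s. s \<in> hom C E Z \<and> (\<forall>i\<in>I. s \<cdot> inc i = x (inc i))"
      by (intro is_coproduct_ex1[OF cp Z]) (simp add: xD(1-3) cpD hom_def)
    then obtain s where s: "s \<in> Ar C" "Dom C s = E" "Cod C s = Z"
        "\<And>i. i \<in> I \<Longrightarrow> s \<cdot> inc i = x (inc i)"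
      by (auto simp: hom_def)
    have "s \<cdot> (inc i \<cdot> g) = x (inc i \<cdot> g)"
      if "i \<in> I" "g \<in> Ar C" "Cod C g = Dom C (inc i)" for i g
      using that s xD(4)[OF that] cpD by (simp flip: assoc)
    then show "\<exists>s\<in>hom C E Z. \<forall>k\<in>generated_sieve C (inc ` I). s \<cdot> k = x k"
      using s by (intro bexI[of _ s]) (auto simp: generated_sieve_def hom_def)
  next
    fix Z s t assume Z: "Z \<in> Ob C" and st: "s \<in> hom C E Z" "t \<in> hom C E Z"
      "\<forall>k\<in>generated_sieve C (inc ` I). s \<cdot> k = t \<cdot> k"
    have "\<exists>!r. r \<in> hom C E Z \<and> (\<forall>i\<in>I. r \<cdot> inc i = s \<cdot> inc i)"
      using cpD homD[OF st(1)] by (intro is_coproduct_ex1[OF cp Z]) (simp add: hom_def)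
    moreover have "\<forall>i\<in>I. t \<cdot> inc i = s \<cdot> inc i" using st(3) inc by simp
    ultimately show "s = t" using st(1,2) by blast
  }
qed

text \<open>Composable arrows are equal here, so returning the first argument is a correct
  composition.\<close>

lemma category_discrete:
  "category \<lparr>Ob = I, Ar = I, Dom = id, Cod = id, Idn = id, Comp = (\<lambda>a b. a)\<rparr>"
  by unfold_locales (auto simp: hom_def)

lemma coproduct_exists:
  fixes \<kappa> :: "'u rel" and I :: "'u set"
  assumes cc: "cocomplete \<kappa> C" and I: "small \<kappa> I" and A: "\<And>i. i \<in> I \<Longrightarrow> A i \<in> Ob C"
  obtains E inc where "is_coproduct C I A E inc"
proof -
  let ?J = "\<lparr>Ob = I, Ar = I, Dom = id, Cod = id, Idn = id, Comp = (\<lambda>a b. a)\<rparr> :: ('u, 'u) cat"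
  let ?F1 = "\<lambda>i. Idn C (A i)"
  \<comment> \<open>The only arrows of the diagram are identities, so naturality of a cocone is
    vacuous.\<close>
  have cocone: "is_cocone ?J C A ?F1 L c \<longleftrightarrow>
      L \<in> Ob C \<and> (\<forall>i\<in>I. c i \<in> hom C (A i) L)" for L c
    unfolding is_cocone_def using idn_right by auto
  have "is_functor ?J C A ?F1"
    using A by (auto simp: is_functor_def hom_def)
  then obtain L c where "is_colimit ?J C A ?F1 L c"
    using cc[unfolded cocomplete_def, rule_format, of ?J A ?F1] I category_discrete[of I] by auto
  then have "is_coproduct C I A L c"
    using A unfolding is_colimit_def is_coproduct_def cocone by simp
  then show thesis by (rule that)
qed

text \<open>By stability the pulled-back inclusions \<open>q i\<close> again form a coproduct, now
  on the domain of \<open>g\<close>. They generate the pullback sieve, which is therefore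
  effective.\<close>

lemma universally_effective_coproduct:
  fixes \<kappa> :: "'u rel" and I :: "'u set"
  assumes cc: "cocomplete \<kappa> C" and sd: "stable_disjoint_coproducts \<kappa> C" and pbs: "has_pullbacks C"
    and I: "small \<kappa> I" and cp: "is_coproduct C I A E inc"
  shows "generated_sieve C (inc ` I) \<in> universally_effective_sieves C E"
  unfolding universally_effective_sieves_def
proof (intro CollectI conjI ballI impI)
  note cpD = is_coproductD[OF cp]
  show "sieve C E (generated_sieve C (inc ` I))"
    using cpD by (intro sieve_generated_sieve) auto
  fix g assume g: "g \<in> Ar C" "Cod C g = E"
  have "\<forall>i\<in>I. \<exists>P p q. is_pullback C (inc i) g P p q"
    using pbs g cpD unfolding has_pullbacks_def by metis
  then obtain P p q where pb: "\<And>i. i \<in> I \<Longrightarrow> is_pullback C (inc i) g (P i) (p i) (q i)"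
    by metis
  note pbD = is_pullbackD[OF pb]
  have P: "P i \<in> Ob C" if "i \<in> I" for i using dom_Ob pbD(4,6) that by metis
  obtain Q k where Q: "is_coproduct C I P Q k"
    using coproduct_exists[OF cc I, of P] P by blast
  have "\<exists>!u. u \<in> hom C Q (Dom C g) \<and> (\<forall>i\<in>I. u \<cdot> k i = q i)"
    using pbD g by (intro is_coproduct_ex1[OF Q]) (simp_all add: hom_def)
  then obtain u where u: "u \<in> hom C Q (Dom C g)" "\<And>i. i \<in> I \<Longrightarrow> u \<cdot> k i = q i" by blast
  have "stable_coproduct C I E inc"
    using sd I cp unfolding stable_disjoint_coproducts_def by blast
  then have iso: "is_iso C u"
    unfolding stable_coproduct_def using g Q u is_pullback_sym[OF pb] by blast
  have "effective_sieve C (Dom C g) (generated_sieve C ((\<lambda>i. u \<cdot> k i) ` I))"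
    using effective_sieve_coproduct[OF is_coproduct_iso[OF Q iso]] homD[OF u(1)] by simp
  moreover have "(\<lambda>i. u \<cdot> k i) ` I = q ` I" using u(2) by simp
  ultimately show "effective_sieve C (Dom C g) (pullback_sieve C g (generated_sieve C (inc ` I)))"
    using pullback_generated_sieve[of I inc g P p q, OF pb g(1)] by simp
qed

text \<open>The sieve of the family lies inside the sieve of \<open>u\<close>, which gives one
  direction. For the other, the sieve of the family pulled back along \<open>u\<close> contains the
  coproduct inclusions, so transitivity along the sieve of \<open>u\<close> applies.\<close>

lemma universally_effective_family_iff:
  fixes \<kappa> :: "'u rel" and I :: "'u set"
  assumes cc: "cocomplete \<kappa> C" and sd: "stable_disjoint_coproducts \<kappa> C" and pbs: "has_pullbacks C"
    and I: "small \<kappa> I" and f: "\<And>i. i \<in> I \<Longrightarrow> f i \<in> Ar C \<and> Cod C (f i) = X"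
    and cp: "is_coproduct C I (\<lambda>i. Dom C (f i)) E inc"
    and u: "u \<in> hom C E X" "\<And>i. i \<in> I \<Longrightarrow> u \<cdot> inc i = f i"
  shows "generated_sieve C (f ` I) \<in> universally_effective_sieves C X \<longleftrightarrow>
    universal_effective_epi C u"
proof -
  note cpD = is_coproductD[OF cp] and uD = homD[OF u(1)]
  have svf: "sieve C X (generated_sieve C (f ` I))" using f by (intro sieve_generated_sieve) auto
  have svu: "sieve C X (generated_sieve C {u})" using uD by (intro sieve_generated_sieve) auto
  have epi: "universal_effective_epi C u \<longleftrightarrow>
      generated_sieve C {u} \<in> universally_effective_sieves C X"
    using universal_effective_epi_iff[OF uD(1) pbs] uD by simp
  have "f ` I \<subseteq> generated_sieve C {u}"
    using u(2)[symmetric] cpD uD unfolding generated_sieve_def by fastforce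
  then have sub: "generated_sieve C (f ` I) \<subseteq> generated_sieve C {u}"
    using generated_sieve_subset[OF svu] by simp
  have "generated_sieve C (f ` I) \<in> universally_effective_sieves C X"
    if "generated_sieve C {u} \<in> universally_effective_sieves C X"
  proof (rule universally_effective_transitive[OF that svf])
    have "inc ` I \<subseteq> pullback_sieve C u (generated_sieve C (f ` I))"
      using u(2) cpD uD f by (auto simp: pullback_sieve_def intro: generator_mem_generated_sieve)
    moreover have sv: "sieve C E (pullback_sieve C u (generated_sieve C (f ` I)))"
      using sieve_pullback_sieve[OF svf uD(1,3)] uD(2) by simp
    ultimately have ue: "pullback_sieve C u (generated_sieve C (f ` I))
        \<in> universally_effective_sieves C E"
      using universally_effective_superset[OF universally_effective_coproduct[OF cc sd pbs I cp] sv]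
        generated_sieve_subset[OF sv] by blast
    fix h assume "h \<in> generated_sieve C {u}"
    then obtain g where g: "h = u \<cdot> g" "g \<in> Ar C" "Cod C g = Dom C u"
      unfolding generated_sieve_def by blast
    then show "pullback_sieve C h (generated_sieve C (f ` I))
        \<in> universally_effective_sieves C (Dom C h)"
      using universally_effective_pullback_sieve[OF ue, of g] uD
      by (simp add: pullback_sieve_comp)
  qed
  then show ?thesis
    using epi universally_effective_superset[OF _ svu sub] by blast
qed

lemma mem_coproduct_basis_iff:
  assumes cc: "cocomplete \<kappa> C" and sd: "stable_disjoint_coproducts \<kappa> C" and pbs: "has_pullbacks C"
    and X: "X \<in> Ob C"
  shows "(I, f) \<in> coproduct_basis \<kappa> C X \<longleftrightarrow> family_on \<kappa> C X (I, f) \<and>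
    generated_sieve C (f ` I) \<in> universally_effective_sieves C X"
proof -
  {
    assume fam: "family_on \<kappa> C X (I, f)"
    then have I: "small \<kappa> I" and f: "\<And>i. i \<in> I \<Longrightarrow> f i \<in> Ar C \<and> Cod C (f i) = X"
      by (simp_all add: family_on_def)
    have iff: "generated_sieve C (f ` I) \<in> universally_effective_sieves C X \<longleftrightarrow>
        universal_effective_epi C u"
      if "is_coproduct C I (\<lambda>i. Dom C (f i)) E inc" "u \<in> hom C E X" "\<forall>i\<in>I. u \<cdot> inc i = f i"
      for E inc u
      using universally_effective_family_iff[OF cc sd pbs I f that(1,2)] that(3) by blast
    obtain E inc where E: "is_coproduct C I (\<lambda>i. Dom C (f i)) E inc"
      using coproduct_exists[OF cc I, of "\<lambda>i. Dom C (f i)"] f dom_Ob by blast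
    have "\<exists>!u. u \<in> hom C E X \<and> (\<forall>i\<in>I. u \<cdot> inc i = f i)"
      using f X by (intro is_coproduct_ex1[OF E]) (simp_all add: hom_def)
    then obtain u where "u \<in> hom C E X" "\<forall>i\<in>I. u \<cdot> inc i = f i" by blast
    \<comment> \<open>The equivalence holds for every choice of coproduct and induced map, and some
      choice exists, so the existential can be eliminated.\<close>
    with E iff have "(\<exists>E inc u. is_coproduct C I (\<lambda>i. Dom C (f i)) E inc \<and>
        u \<in> hom C E X \<and> (\<forall>i\<in>I. u \<cdot> inc i = f i) \<and> universal_effective_epi C u) \<longleftrightarrow>
      generated_sieve C (f ` I) \<in> universally_effective_sieves C X"
      by blast
  }
  then show ?thesis unfolding coproduct_basis_def by auto
qed

end

section \<open>The coproduct basis and its topology\<close>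

lemma small_embeds:
  fixes \<kappa> :: "'u rel"
  assumes "Cinfinite \<kappa>" "small \<kappa> A"
  obtains b and L :: "'u set" where "bij_betw b L A"
proof -
  have "\<kappa> =o |Field \<kappa>|" using assms(1) card_of_Field_ordIso ordIso_symmetric by blast
  then have "|A| \<le>o |Field \<kappa>|"
    using assms(2) ordLess_imp_ordLeq ordLeq_ordIso_trans unfolding small_def by blast
  \<comment> \<open>The inverse of an injection into the field of \<open>\<kappa>\<close> enumerates
    \<open>A\<close> by elements of \<open>'u\<close>.\<close>
  then obtain g where g: "inj_on g A" "g ` A \<subseteq> Field \<kappa>"
    unfolding card_of_ordLeq[symmetric] by blast
  then have "bij_betw (inv_into A g) (g ` A) A"
    by (simp add: bij_betw_inv_into inj_on_imp_bij_betw)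
  then show thesis by (rule that)
qed

lemma small_bij: "bij_betw b L A \<Longrightarrow> small \<kappa> L \<longleftrightarrow> small \<kappa> A"
proof -
  assume "bij_betw b L A"
  then have LA: "|L| =o |A|" by (rule card_of_ordIsoI)
  show ?thesis
    unfolding small_def
    using ordIso_ordLess_trans[OF LA] ordIso_ordLess_trans[OF ordIso_symmetric[OF LA]] by metis
qed

lemma small_image: "small \<kappa> A \<Longrightarrow> small \<kappa> (f ` A)"
  unfolding small_def using card_of_image ordLeq_ordLess_trans by blast

lemma small_singleton: "Cinfinite \<kappa> \<Longrightarrow> small \<kappa> {x}"
  unfolding small_def cinfinite_def
  using finite_ordLess_infinite[OF card_of_Well_order[of "{x}"], of \<kappa>] Card_order_wo_rel[of \<kappa>]
  by (simp add: Field_card_of wo_rel_def)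

text \<open>Regularity of the cardinal enters here, through stability under small sums.\<close>

lemma small_Sigma:
  assumes "Cinfinite \<kappa>" "regularCard \<kappa>" "small \<kappa> I" "\<And>i. i \<in> I \<Longrightarrow> small \<kappa> (J i)"
  shows "small \<kappa> (Sigma I J)"
  using stable_elim[OF regularCard_stable[of \<kappa>], of I J] assms
  unfolding small_def cinfinite_def by blast

locale coproduct_site = category C for C :: "('o, 'a) cat" (structure) +
  fixes \<kappa> :: "'u rel"
  assumes Cinf: "Cinfinite \<kappa>" and reg: "regularCard \<kappa>"
    and cc: "cocomplete \<kappa> C" and sd: "stable_disjoint_coproducts \<kappa> C" and pbs: "has_pullbacks C"
begin

section \<open>The axioms of a Grothendieck basis\<close>

lemmas basis_iff = mem_coproduct_basis_iff[OF cc sd pbs]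

lemma basis_small: "(I, f) \<in> coproduct_basis \<kappa> C X \<Longrightarrow> small \<kappa> I"
  by (simp add: coproduct_basis_def family_on_def)

text \<open>A right inverse \<open>g\<close> gives \<open>k = f \<cdot> (g \<cdot> k)\<close> for
  every \<open>k\<close> into the codomain of \<open>f\<close>, so \<open>f\<close> generates the
  maximal sieve.\<close>

lemma basis_iso:
  assumes "is_iso C f"
  shows "({i}, \<lambda>_. f) \<in> coproduct_basis \<kappa> C (Cod C f)"
proof -
  obtain g where f: "f \<in> Ar C" and g: "g \<in> Ar C" "Dom C g = Cod C f" "Cod C g = Dom C f"
      "f \<cdot> g = Idn C (Cod C f)"
    using assms unfolding is_iso_def by (auto simp: hom_def)
  have "k \<in> generated_sieve C {f}" if k: "k \<in> Ar C" "Cod C k = Cod C f" for k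
  proof -
    have "k = (f \<cdot> g) \<cdot> k" using k f g(4) by simp
    also have "\<dots> = f \<cdot> (g \<cdot> k)" using k f g(1-3) by (intro assoc) simp_all
    finally show ?thesis using k g f unfolding generated_sieve_def by fastforce
  qed
  then have "generated_sieve C {f} = {k \<in> Ar C. Cod C k = Cod C f}"
    using f by (auto simp: generated_sieve_def)
  then show ?thesis
    using f universally_effective_maximal_sieve Cinf
    by (simp add: basis_iff family_on_def small_singleton)
qed

lemma basis_pullback:
  assumes "(I, f) \<in> coproduct_basis \<kappa> C X" "X \<in> Ob C" "g \<in> Ar C" "Cod C g = X"
    and pb: "\<And>i. i \<in> I \<Longrightarrow> is_pullback C (f i) g (P i) (p i) (q i)"
  shows "(I, q) \<in> coproduct_basis \<kappa> C (Dom C g)"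
  using assms universally_effective_pullback_sieve[of "generated_sieve C (f ` I)" X g]
    pullback_generated_sieve[of I f g P p q, OF pb] is_pullbackD[OF pb]
  by (simp add: basis_iff family_on_def)

lemma basis_comp:
  assumes X: "X \<in> Ob C" and f: "(I, f) \<in> coproduct_basis \<kappa> C X"
    and g: "\<And>i. i \<in> I \<Longrightarrow> (J i, g i) \<in> coproduct_basis \<kappa> C (Dom C (f i))"
    and b: "bij_betw b L (Sigma I J)"
  shows "(L, \<lambda>l. case b l of (i, j) \<Rightarrow> f i \<cdot> g i j) \<in> coproduct_basis \<kappa> C X"
proof -
  let ?h = "\<lambda>l. case b l of (i, j) \<Rightarrow> f i \<cdot> g i j"
  have fD: "f i \<in> Ar C" "Cod C (f i) = X" if "i \<in> I" for i
    using f that X by (simp_all add: basis_iff family_on_def)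
  have gD: "g i j \<in> Ar C" "Cod C (g i j) = Dom C (f i)" if "i \<in> I" "j \<in> J i" for i j
    using g[OF that(1)] that fD by (simp_all add: basis_iff family_on_def)
  have "small \<kappa> (Sigma I J)"
    using basis_small[OF f] basis_small[OF g] by (rule small_Sigma[OF Cinf reg])
  then have L: "small \<kappa> L" using small_bij[OF b, of \<kappa>] by simp
  \<comment> \<open>The generated sieve depends only on the image of the family, where the
    reindexing \<open>b\<close> is no longer visible.\<close>
  have h: "?h ` L = {f i \<cdot> g i j | i j. i \<in> I \<and> j \<in> J i}"
  proof -
    have "?h ` L = (\<lambda>(i, j). f i \<cdot> g i j) ` (b ` L)" by (simp add: image_image)
    also have "\<dots> = {f i \<cdot> g i j | i j. i \<in> I \<and> j \<in> J i}"
      using b by (force simp: bij_betw_def)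
    finally show ?thesis .
  qed
  have hD: "k \<in> Ar C \<and> Cod C k = X" if "k \<in> ?h ` L" for k
    using that fD gD unfolding h by auto
  have sv: "sieve C X (generated_sieve C (?h ` L))"
    using hD by (rule sieve_generated_sieve)
  have "generated_sieve C (f ` I) \<in> universally_effective_sieves C X"
    using f X by (simp add: basis_iff)
  then have "generated_sieve C (?h ` L) \<in> universally_effective_sieves C X"
  proof (rule universally_effective_transitive[OF _ sv])
    fix k assume "k \<in> generated_sieve C (f ` I)"
    then obtain i m where i: "i \<in> I" and m: "k = f i \<cdot> m" "m \<in> Ar C" "Cod C m = Dom C (f i)"
      unfolding generated_sieve_def by blast
    \<comment> \<open>The pullback along \<open>k = f i \<cdot> m\<close> is taken in two steps:
      along \<open>f i\<close>, where the result contains the generators \<open>g i j\<close>, and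
      then along \<open>m\<close>.\<close>
    let ?R = "pullback_sieve C (f i) (generated_sieve C (?h ` L))"
    have R: "sieve C (Dom C (f i)) ?R" using sieve_pullback_sieve[OF sv] fD i by simp
    have "f i \<cdot> g i j \<in> generated_sieve C (?h ` L)" if "j \<in> J i" for j
    proof (rule generator_mem_generated_sieve)
      show "f i \<cdot> g i j \<in> ?h ` L" unfolding h using i that by blast
    qed (use i that fD gD in simp)
    then have "g i ` J i \<subseteq> ?R" using i gD by (auto simp: pullback_sieve_def)
    then have "generated_sieve C (g i ` J i) \<subseteq> ?R" by (rule generated_sieve_subset[OF R])
    moreover have "generated_sieve C (g i ` J i) \<in> universally_effective_sieves C (Dom C (f i))"
      using g[OF i] fD[OF i] by (simp add: basis_iff)
    ultimately have "?R \<in> universally_effective_sieves C (Dom C (f i))"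
      using universally_effective_superset[OF _ R] by blast
    then show "pullback_sieve C k (generated_sieve C (?h ` L))
        \<in> universally_effective_sieves C (Dom C k)"
      using universally_effective_pullback_sieve[of ?R _ m] m fD[OF i]
      by (simp add: pullback_sieve_comp)
  qed
  then show ?thesis using L hD X by (simp add: basis_iff family_on_def)
qed

lemma grothendieck_basis_coproduct_basis: "grothendieck_basis \<kappa> C (coproduct_basis \<kappa> C)"
  unfolding grothendieck_basis_def
proof (intro conjI ballI allI impI)
  fix X F assume "X \<in> Ob C" "F \<in> coproduct_basis \<kappa> C X"
  then show "family_on \<kappa> C X F" by (cases F) (simp add: basis_iff)
qed (use basis_iso basis_pullback basis_comp in blast)+

section \<open>The generated topology and its maximality\<close>

abbreviation G :: "'o \<Rightarrow> 'a set set" where "G \<equiv> generated_topology C (coproduct_basis \<kappa> C)"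

lemma generated_topology_memI:
  "sieve C X S \<Longrightarrow> (I, f) \<in> coproduct_basis \<kappa> C X \<Longrightarrow> f ` I \<subseteq> S \<Longrightarrow> S \<in> G X"
  unfolding generated_topology_def by blast

lemma generated_topology_memE:
  assumes "S \<in> G X"
  obtains I f where "sieve C X S" "(I, f) \<in> coproduct_basis \<kappa> C X" "f ` I \<subseteq> S"
  using assms unfolding generated_topology_def by blast

lemma generated_topology_universally_effective:
  assumes X: "X \<in> Ob C" and S: "S \<in> G X"
  shows "S \<in> universally_effective_sieves C X"
  using S
proof (rule generated_topology_memE)
  fix I f assume sv: "sieve C X S" and If: "(I, f) \<in> coproduct_basis \<kappa> C X" "f ` I \<subseteq> S"
  then have "generated_sieve C (f ` I) \<in> universally_effective_sieves C X"
    using X by (simp add: basis_iff)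
  then show ?thesis
    using universally_effective_superset sv generated_sieve_subset[OF sv If(2)] by blast
qed

lemma generated_topology_pullback:
  assumes X: "X \<in> Ob C" and S: "S \<in> G X" and h: "h \<in> Ar C" "Cod C h = X"
  shows "pullback_sieve C h S \<in> G (Dom C h)"
  using S
proof (rule generated_topology_memE)
  fix I f assume sv: "sieve C X S" and f: "(I, f) \<in> coproduct_basis \<kappa> C X" "f ` I \<subseteq> S"
  have "\<forall>i\<in>I. f i \<in> Ar C \<and> Cod C (f i) = X"
    using f X by (simp add: basis_iff family_on_def)
  then have "\<forall>i\<in>I. \<exists>P p q. is_pullback C (f i) h P p q"
    using pbs h unfolding has_pullbacks_def by metis
  then obtain P p q where pb: "\<And>i. i \<in> I \<Longrightarrow> is_pullback C (f i) h (P i) (p i) (q i)"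
    by metis
  have "q i \<in> pullback_sieve C h S" if i: "i \<in> I" for i
  proof -
    note pbD = is_pullbackD[OF pb[OF i]]
    have "f i \<cdot> p i \<in> S" using sieveD(3)[OF sv, of "f i" "p i"] f i pbD by auto
    then show ?thesis using pbD by (simp add: pullback_sieve_def)
  qed
  then show ?thesis
    using basis_pullback[OF f(1) X h pb] sieve_pullback_sieve[OF sv h]
    by (intro generated_topology_memI) auto
qed

text \<open>Each \<open>f i\<close> in a basis family inside \<open>S\<close> is refined by a basis
  family whose composites lie in \<open>R\<close>; all these composites together form a basis
  family.\<close>

lemma generated_topology_transitive:
  assumes X: "X \<in> Ob C" and S: "S \<in> G X" and R: "sieve C X R"
    and loc: "\<And>h. h \<in> S \<Longrightarrow> pullback_sieve C h R \<in> G (Dom C h)"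
  shows "R \<in> G X"
  using S
proof (rule generated_topology_memE)
  fix I f assume sv: "sieve C X S" and f: "(I, f) \<in> coproduct_basis \<kappa> C X" "f ` I \<subseteq> S"
  have "\<forall>i\<in>I. \<exists>J g. (J, g) \<in> coproduct_basis \<kappa> C (Dom C (f i)) \<and>
      g ` J \<subseteq> pullback_sieve C (f i) R"
  proof
    fix i assume "i \<in> I"
    then have "pullback_sieve C (f i) R \<in> G (Dom C (f i))" using loc f(2) by blast
    then show "\<exists>J g. (J, g) \<in> coproduct_basis \<kappa> C (Dom C (f i)) \<and>
        g ` J \<subseteq> pullback_sieve C (f i) R"
      by (rule generated_topology_memE) blast
  qed
  then obtain J g where
    g: "\<And>i. i \<in> I \<Longrightarrow> (J i, g i) \<in> coproduct_basis \<kappa> C (Dom C (f i))"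
    and gR: "\<And>i. i \<in> I \<Longrightarrow> g i ` J i \<subseteq> pullback_sieve C (f i) R"
    by metis
  have "small \<kappa> (Sigma I J)"
    using basis_small[OF f(1)] basis_small[OF g] by (rule small_Sigma[OF Cinf reg])
  \<comment> \<open>The composite family is indexed by pairs; a basis family needs an index set in
    \<open>'u\<close>.\<close>
  then obtain b and L :: "'u set" where b: "bij_betw b L (Sigma I J)"
    using small_embeds[OF Cinf] by blast
  have "(\<lambda>l. case b l of (i, j) \<Rightarrow> f i \<cdot> g i j) ` L \<subseteq> R"
  proof (intro image_subsetI)
    fix l assume "l \<in> L"
    then have "b l \<in> Sigma I J" using b by (auto simp: bij_betw_def)
    then obtain i j where "b l = (i, j)" "i \<in> I" "j \<in> J i" by blast
    then show "(case b l of (i, j) \<Rightarrow> f i \<cdot> g i j) \<in> R"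
      using gR by (auto simp: pullback_sieve_def)
  qed
  then show ?thesis
    using generated_topology_memI[OF R basis_comp[OF X f(1) g b]] by blast
qed

lemma generated_topology_maximal_sieve:
  assumes "X \<in> Ob C"
  shows "{f \<in> Ar C. Cod C f = X} \<in> G X"
proof (rule generated_topology_memI)
  have "is_iso C (Idn C X)"
    using assms by (auto simp: is_iso_def hom_def intro!: bexI[of _ "Idn C X"])
  \<comment> \<open>\<open>undefined\<close> is an arbitrary element of \<open>'u\<close>, serving
    as the sole index.\<close>
  from basis_iso[OF this, of undefined]
  show "({undefined}, \<lambda>_. Idn C X) \<in> coproduct_basis \<kappa> C X" using assms by simp
qed (use assms in \<open>auto simp: sieve_def\<close>)

lemma grothendieck_topology_generated: "grothendieck_topology C G"
  unfolding grothendieck_topology_def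
proof (intro conjI ballI allI impI)
  fix X S assume "S \<in> G X"
  then show "sieve C X S" by (rule generated_topology_memE)
qed (use generated_topology_maximal_sieve generated_topology_pullback
    generated_topology_transitive in blast)+

lemma subcanonical_generated: "subcanonical_topology C G"
  using grothendieck_topology_generated generated_topology_universally_effective
    universally_effective_sieve_effective
  by (simp add: subcanonical_iff_effective)

lemma small_covers_generated: "small_covers \<kappa> C G"
  unfolding small_covers_def
proof (intro ballI)
  fix X S assume X: "X \<in> Ob C" and "S \<in> G X"
  then obtain I f where f: "(I, f) \<in> coproduct_basis \<kappa> C X" "f ` I \<subseteq> S"
    by (auto elim: generated_topology_memE)
  then have fam: "small \<kappa> I" "\<And>i. i \<in> I \<Longrightarrow> f i \<in> Ar C \<and> Cod C (f i) = X"
    using X by (simp_all add: basis_iff family_on_def)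
  have "generated_sieve C (f ` I) \<in> G X"
  proof (rule generated_topology_memI[OF _ f(1)])
    show "sieve C X (generated_sieve C (f ` I))"
      using fam by (intro sieve_generated_sieve) auto
    show "f ` I \<subseteq> generated_sieve C (f ` I)"
      using fam by (auto intro: generator_mem_generated_sieve)
  qed
  then show "\<exists>F\<subseteq>S. small \<kappa> F \<and> generated_sieve C F \<in> G X"
    using f(2) small_image[OF fam(1)] by blast
qed

text \<open>The small generating part of a cover, indexed by elements of \<open>'u\<close>,
  generates a universally effective sieve and is therefore a basis family.\<close>

lemma subcanonical_small_covers_subset:
  assumes T: "subcanonical_topology C T" "small_covers \<kappa> C T" and X: "X \<in> Ob C"
  shows "T X \<subseteq> G X"
proof
  fix S assume S: "S \<in> T X"
  then obtain F where F: "F \<subseteq> S" "small \<kappa> F" "generated_sieve C F \<in> T X"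
    using T(2) X unfolding small_covers_def by metis
  have sv: "sieve C X S"
    using T(1) S X unfolding subcanonical_topology_def grothendieck_topology_def by blast
  obtain b and L :: "'u set" where b: "bij_betw b L F"
    using small_embeds[OF Cinf F(2)] by blast
  have bL: "b ` L = F" using b by (simp add: bij_betw_def)
  have "generated_sieve C F \<in> universally_effective_sieves C X"
    using subcanonical_subset_universally_effective[OF T(1) X] F(3) by blast
  moreover have "b l \<in> Ar C \<and> Cod C (b l) = X" if "l \<in> L" for l
    using that bL F(1) sieveD[OF sv] by blast
  ultimately have "(L, b) \<in> coproduct_basis \<kappa> C X"
    using X bL small_bij[OF b, of \<kappa>] F(2) by (simp add: basis_iff family_on_def)
  then show "S \<in> G X"
    using generated_topology_memI[OF sv] bL F(1) by blast
qed

lemma small_canonical_topology_generated: "small_canonical_topology \<kappa> C G"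
  unfolding small_canonical_topology_def
  using subcanonical_generated small_covers_generated subcanonical_small_covers_subset by blast

lemma canonical_topology_generated:
  assumes "\<forall>T. canonical_topology C T \<longrightarrow> small_covers \<kappa> C T"
  shows "canonical_topology C G"
proof -
  let ?T = "universally_effective_sieves C"
  have can: "canonical_topology C ?T" by (rule canonical_topology_universally_effective)
  \<comment> \<open>The assumption is instantiated with the topology of universally effective
    sieves, which makes it one of the topologies compared with \<open>G\<close>.\<close>
  then have "?T X \<subseteq> G X" if "X \<in> Ob C" for X
    using that assms subcanonical_small_covers_subset unfolding canonical_topology_def by blast
  then show ?thesis
    unfolding canonical_topology_def
    using subcanonical_generated subcanonical_subset_universally_effective by blast
qed

end

theorem theorem6p4:
  fixes \<kappa> :: "'u rel" and C :: "('o, 'a) cat"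
  assumes "Cinfinite \<kappa>" and "regularCard \<kappa>"
    and "category C"
    and "cocomplete \<kappa> C"
    and "stable_disjoint_coproducts \<kappa> C"
    and "has_pullbacks C"
  shows "grothendieck_basis \<kappa> C (coproduct_basis \<kappa> C)
    \<and> small_canonical_topology \<kappa> C (generated_topology C (coproduct_basis \<kappa> C))
    \<and> ((\<forall>T. canonical_topology C T \<longrightarrow> small_covers \<kappa> C T) \<longrightarrow>
        canonical_topology C (generated_topology C (coproduct_basis \<kappa> C)))"
proof -
  interpret coproduct_site C \<kappa>
    using assms by (intro coproduct_site.intro coproduct_site_axioms.intro)
  show ?thesis
    using grothendieck_basis_coproduct_basis small_canonical_topology_generated
      canonical_topology_generated by blast
qed

end
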